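(* Let $F$ be a number field with ring of integers $\mathcal{O}$, and suppose there is a prime $\mathfrak{q} \subset \mathcal{O}$ with $v_{\mathfrak{q}}(2)$ odd. Let $\gamma, m \in \mathcal{O}$ and $f(x) = (x-\gamma)^2 + \gamma + m$. If $\gamma \not\equiv m \pmod{\mathfrak{q}}$ and $-(\gamma+m)$ is not a square in $F$, then $f^n(x)$ is irreducible over $F$ for all $n \geq 1$.
   Context: $f^n$ denotes the $n$-th iterate (the $n$-fold composition) of $f$. $v_{\mathfrak{q}}$ denotes the (normalized) $\mathfrak{q}$-adic valuation for a nonzero prime ideal $\mathfrak{q}$ of $\mathcal{O}$. *)

theory Defs
  imports "HOL-Algebra.Ideal_Product" "HOL-Computational_Algebra.Computational_Algebra"
begin

(* A number field is a type 'a of class field_char_0 that has a finite basis as a vector space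
   over the rationals. *)
definition number_field :: "'a::field_char_0 itself \<Rightarrow> bool" where
  "number_field _ \<longleftrightarrow>
     (\<exists>B::'a set. finite_dimensional_vector_space (\<lambda>(c::rat) x. of_rat c * x) B)"

definition ring_of_integers :: "'a::field_char_0 ring" where
  "ring_of_integers =
     \<lparr>carrier = {x. algebraic_int x}, monoid.mult = (*), one = 1, zero = 0, add = (+)\<rparr>"

(* For a nonzero prime ideal \<qq> of the ring of integers, this is the normalized \<qq>-adic
   valuation, restricted to nonzero integers x: there "\<qq>^n divides (x)" is the same as
   "x \<in> \<qq>^n". The value at x = 0, which should be infinite, is unspecified, as is the value
   at non-integers. *)
definition adic_valuation :: "'a::field_char_0 set \<Rightarrow> 'a \<Rightarrow> nat" where
  "adic_valuation \<qq> x = (GREATEST n. x \<in> \<qq> [^]\<^bsub>ideals_set ring_of_integers\<^esub> n)"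

definition poly_iterate :: "'a::comm_semiring_1 poly \<Rightarrow> nat \<Rightarrow> 'a poly" where
  "poly_iterate f n = (pcompose f ^^ n) [:0, 1:]"

end

theory Submission
  imports Defs "Jordan_Normal_Form.Char_Poly"
begin

text \<open>
  The translation \<open>x = y + \<gamma>\<close> turns \<open>f\<close> into \<open>g(y) = y\<^sup>2 + m\<close> and the \<open>n\<close>-th iterate of \<open>f\<close> into
  \<open>G\<^sub>n(y) = g\<^sup>n(y) + \<gamma>\<close>, up to a translation. The polynomial \<open>G\<^sub>1 = y\<^sup>2 + \<gamma> + m\<close> is irreducible
  because \<open>-(\<gamma> + m)\<close> is not a square, and the others follow by induction from
  \<open>G\<^sub>n\<^sub>+\<^sub>1(y) = P(y\<^sup>2)\<close>, where \<open>P(t) = G\<^sub>n(t + m)\<close> is irreducible.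

  The norm argument of \<open>irreducible_pcompose_square\<close> shows that \<open>P(y\<^sup>2)\<close> can be reducible only
  if \<open>P = A\<^sup>2 - t B\<^sup>2\<close> for some polynomials \<open>A\<close> and \<open>B\<close>. This is refuted at the prime \<open>\<qq>\<close>, using
  only that \<open>P = Q\<^sup>2 + c\<close> with \<open>Q\<close> monic, integral and of positive degree, and with
  \<open>c = \<gamma> + m\<close> a unit at \<open>\<qq>\<close>; the latter is the hypothesis on \<open>\<gamma> - m\<close>, as 2 lies in \<open>\<qq>\<close>.
  Comparing coefficients modulo 2, and then modulo 2 times the maximal ideal, gives the
  contradiction in \<open>square_plus_unit_not_norm_form\<close>. The odd valuation enters between these two
  steps: a square divisible by 2 has a strictly larger valuation than 2.

  The comparison takes place in the localisation of the ring of integers at \<open>\<qq>\<close>. That it is a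
  valuation ring follows from Horner's scheme (\<open>local_or_inverse_local\<close>); that its maximal ideal
  is principal, from a bound on chains of divisors of 2 by the degree of the number field
  (\<open>divisor_chain_bounded\<close>). Together with the maximality of \<open>\<qq>\<close> this relates the powers of
  \<open>\<qq>\<close>, by which the valuation is defined, to those of a uniformizer (\<open>mem_prime_power_iff\<close>),
  and shows that 2 is not a unit times a square (\<open>two_not_unit_times_square\<close>).
\<close>

hide_const (open) module.smult

section \<open>Irreducibility under quadratic substitution\<close>

lemma coeff_pcompose_square:
  "coeff (pcompose P [:0, 0, 1:]) n = (if even n then coeff P (n div 2) else 0)"
  for P :: "'a::comm_ring_1 poly"
proof (induction P arbitrary: n)
  case (pCons a P)
  consider "n = 0" | "n = 1" | k where "n = Suc (Suc k)"
    by (metis One_nat_def not0_implies_Suc)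
  then show ?case
    by cases (auto simp: pcompose_pCons pCons.IH)
qed simp

lemma even_odd_parts:
  fixes h :: "'a::comm_ring_1 poly"
  obtains A B where "h = pcompose A [:0, 0, 1:] + pCons 0 (pcompose B [:0, 0, 1:])"
proof -
  have "\<exists>A B. h = pcompose A [:0, 0, 1:] + pCons 0 (pcompose B [:0, 0, 1:])"
  proof (induction h)
    case 0
    show ?case by (rule exI[of _ 0], rule exI[of _ 0]) simp
  next
    case (pCons a h)
    then obtain A B where "h = pcompose A [:0, 0, 1:] + pCons 0 (pcompose B [:0, 0, 1:])"
      by blast
    then have "pCons a h = pcompose (pCons a B) [:0, 0, 1:] + pCons 0 (pcompose A [:0, 0, 1:])"
      by (simp add: pcompose_pCons)
    then show ?case by blast
  qed
  then show thesis using that by blast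
qed

lemma even_odd_parts_unique:
  fixes A B C D :: "'a::comm_ring_1 poly"
  assumes "pcompose A [:0, 0, 1:] + pCons 0 (pcompose B [:0, 0, 1:]) =
           pcompose C [:0, 0, 1:] + pCons 0 (pcompose D [:0, 0, 1:])" (is "?l = ?r")
  shows "A = C" "B = D"
proof -
  have "coeff A n = coeff C n" for n
    using arg_cong[OF assms, of "\<lambda>p. coeff p (2 * n)"]
    by (cases n) (auto simp: coeff_pcompose_square coeff_pCons poly_0_coeff_0)
  then show "A = C" by (simp add: poly_eq_iff)
  have "coeff B n = coeff D n" for n
    using arg_cong[OF assms, of "\<lambda>p. coeff p (Suc (2 * n))"]
    by (auto simp: coeff_pcompose_square coeff_pCons)
  then show "B = D" by (simp add: poly_eq_iff)
qed

text \<open>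
  Substituting \<open>y\<^sup>2\<close> for the variable \<open>t\<close> makes the polynomials in \<open>y\<close> a quadratic
  extension of those in \<open>t\<close>, with basis \<open>1, y\<close>; the norm of \<open>A(y\<^sup>2) + y B(y\<^sup>2)\<close> is
  \<open>A\<^sup>2 - t B\<^sup>2\<close>. The two terms have degrees of different parity, so they cannot cancel.
\<close>

lemma degree_norm_form:
  fixes A B :: "'a::idom poly"
  shows "degree (A\<^sup>2 - [:0, 1:] * B\<^sup>2) = max (2 * degree A) (if B = 0 then 0 else Suc (2 * degree B))"
proof (cases "B = 0")
  case True
  then show ?thesis by (cases "A = 0") (simp_all add: degree_power_eq)
next
  case False
  then have dB: "degree ([:0, 1:] * B\<^sup>2) = Suc (2 * degree B)"
    by (simp add: degree_mult_eq degree_power_eq)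
  have dA: "degree (A\<^sup>2) = 2 * degree A"
    by (cases "A = 0") (auto simp: degree_power_eq)
  show ?thesis
  proof (cases "2 * degree A < Suc (2 * degree B)")
    case True
    have "degree (A\<^sup>2 - [:0, 1:] * B\<^sup>2) = degree (- ([:0, 1:] * B\<^sup>2))"
      unfolding diff_conv_add_uminus
      by (rule degree_add_eq_right) (use True dA dB in \<open>simp only: degree_minus\<close>)
    then show ?thesis using True False dB unfolding degree_minus by simp
  next
    case g: False
    have "degree (A\<^sup>2 - [:0, 1:] * B\<^sup>2) = degree (A\<^sup>2)"
      unfolding diff_conv_add_uminus
      by (rule degree_add_eq_left) (unfold degree_minus dA dB, use g in presburger)
    then show ?thesis using g False dA by simp
  qed
qed

lemma lead_coeff_norm_form:
  fixes A B :: "'a::idom poly"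
  assumes "even (degree (A\<^sup>2 - [:0, 1:] * B\<^sup>2))"
  shows "lead_coeff (A\<^sup>2 - [:0, 1:] * B\<^sup>2) = (lead_coeff A)\<^sup>2"
proof -
  have d: "degree (A\<^sup>2 - [:0, 1:] * B\<^sup>2) = 2 * degree A"
    using degree_norm_form[of A B] assms by (auto simp: max_def split: if_splits)
  have "degree ([:0, 1:] * B\<^sup>2) < 2 * degree A" if "B \<noteq> 0"
    using degree_norm_form[of A B] d that
    by (simp add: degree_mult_eq degree_power_eq max_def split: if_splits) presburger
  then have "coeff ([:0, 1:] * B\<^sup>2) (2 * degree A) = 0"
    by (cases "B = 0") (auto simp: coeff_eq_0)
  moreover have "coeff (A\<^sup>2) (2 * degree A) = (lead_coeff A)\<^sup>2"
    by (metis coeff_mult_degree_sum mult_2 power2_eq_square)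
  ultimately show ?thesis unfolding d by simp
qed

text \<open>
  If \<open>P(y\<^sup>2) = h k\<close>, then taking norms gives \<open>P\<^sup>2 = N(h) N(k)\<close>. As \<open>P\<close> is prime and
  a polynomial of constant norm is constant, a proper factorisation forces \<open>N(h)\<close> to be a
  constant multiple of \<open>P\<close>. The degree of \<open>P\<close> being even, that constant is the square of the
  leading coefficient of the even part of \<open>h\<close>, and dividing \<open>h\<close> by this coefficient makes
  \<open>P\<close> itself a norm.
\<close>

theorem irreducible_pcompose_square:
  fixes P :: "'a::field poly"
  assumes irr: "Factorial_Ring.irreducible P" and monic: "lead_coeff P = 1"
    and even: "even (degree P)"
    and no_norm: "\<And>A B. P \<noteq> A\<^sup>2 - [:0, 1:] * B\<^sup>2"
  shows "Factorial_Ring.irreducible (pcompose P [:0, 0, 1:])"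
proof (rule irreducibleI)
  have P0: "P \<noteq> 0" using irr by auto
  have dP: "degree P > 0" using irr P0 by (auto simp: Factorial_Ring.irreducible_def is_unit_iff_degree)
  then have d: "degree (pcompose P [:0, 0, 1:]) > 0" by (simp add: degree_pcompose)
  then show "pcompose P [:0, 0, 1:] \<noteq> 0" by force
  then show "\<not> is_unit (pcompose P [:0, 0, 1:])" using d by (simp add: is_unit_iff_degree)
  fix h k :: "'a poly" assume hk: "pcompose P [:0, 0, 1:] = h * k"
  obtain A B where h: "h = pcompose A [:0, 0, 1:] + pCons 0 (pcompose B [:0, 0, 1:])"
    by (rule even_odd_parts)
  obtain C D where k: "k = pcompose C [:0, 0, 1:] + pCons 0 (pcompose D [:0, 0, 1:])"
    by (rule even_odd_parts)
  have "pcompose P [:0, 0, 1:] + pCons 0 (pcompose 0 [:0, 0, 1:]) =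
        pcompose (A * C + [:0, 1:] * (B * D)) [:0, 0, 1:] + pCons 0 (pcompose (A * D + B * C) [:0, 0, 1:])"
    using hk unfolding h k
    by (simp add: pcompose_mult pcompose_add pcompose_pCons algebra_simps)
  from even_odd_parts_unique[OF this]
  have parts: "P = A * C + [:0, 1:] * (B * D)" "0 = A * D + B * C" by blast+
  define M N where "M = A\<^sup>2 - [:0, 1:] * B\<^sup>2" and "N = C\<^sup>2 - [:0, 1:] * D\<^sup>2"
  \<comment> \<open>Multiplicativity of the norm, in coordinates.\<close>
  have "M * N = (A * C + [:0, 1:] * (B * D))\<^sup>2 - [:0, 1:] * (A * D + B * C)\<^sup>2"
    unfolding M_def N_def power2_eq_square by (simp only: algebra_simps)
  then have MN: "M * N = P * P"
    by (simp only: parts(1)[symmetric] parts(2)[symmetric]) (simp add: power2_eq_square)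
  have h0: "h \<noteq> 0" "k \<noteq> 0" using hk \<open>pcompose P [:0, 0, 1:] \<noteq> 0\<close> by auto
  have const: "is_unit h'" if "is_unit (A\<^sup>2 - [:0, 1:] * B\<^sup>2)" "h' \<noteq> 0"
     "h' = pcompose A [:0, 0, 1:] + pCons 0 (pcompose B [:0, 0, 1:])" for A B h' :: "'a poly"
  proof -
    have "A\<^sup>2 - [:0, 1:] * B\<^sup>2 \<noteq> 0" using that(1) by auto
    then have "degree (A\<^sup>2 - [:0, 1:] * B\<^sup>2) = 0" using that(1) by (simp add: is_unit_iff_degree)
    then have "B = 0" "degree A = 0" unfolding degree_norm_form by (auto split: if_splits)
    then have "degree h' = 0" unfolding that(3) by (simp add: degree_pcompose)
    then show ?thesis using that(2) by (simp add: is_unit_iff_degree)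
  qed
  have no_assoc: "False" if "P * u = A\<^sup>2 - [:0, 1:] * B\<^sup>2" "is_unit u" for u A B
  proof -
    have "u \<noteq> 0" using that(2) by auto
    then have "degree u = 0" using that(2) by (simp add: is_unit_iff_degree)
    then obtain l where u: "u = [:l:]" by (auto elim: degree_eq_zeroE)
    have l: "l \<noteq> 0" using \<open>u \<noteq> 0\<close> u by simp
    have Pl: "A\<^sup>2 - [:0, 1:] * B\<^sup>2 = smult l P" using that(1) u by simp
    have "even (degree (A\<^sup>2 - [:0, 1:] * B\<^sup>2))" unfolding Pl using even l by simp
    from lead_coeff_norm_form[OF this] have "lead_coeff (smult l P) = (lead_coeff A)\<^sup>2"
      unfolding Pl .
    then have la: "l = (lead_coeff A)\<^sup>2" unfolding lead_coeff_smult monic by simp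
    define a where "a = lead_coeff A"
    have "P = smult (1 / l) (A\<^sup>2 - [:0, 1:] * B\<^sup>2)"
      unfolding Pl using l by simp
    also have "\<dots> = (smult (1 / a) A)\<^sup>2 - [:0, 1:] * (smult (1 / a) B)\<^sup>2"
      using la[folded a_def]
      by (simp add: smult_diff_right power2_eq_square)
    finally show False using no_norm by blast
  qed
  have prime: "prime_elem P" using irr by (rule field_poly_irreducible_imp_prime)
  have dvd: "is_unit N'" if MN: "M' * N' = P * P" and dv: "P dvd M'" and
      na: "\<And>u. P * u = M' \<Longrightarrow> is_unit u \<Longrightarrow> False" for M' N'
  proof -
    obtain u where u: "M' = P * u" using dv by blast
    then have "P = u * N'" using MN P0 by (simp add: mult.assoc)
    then have "is_unit u \<or> is_unit N'" using irr by (blast dest: irreducibleD)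
    then show ?thesis using na u by auto
  qed
  have "P dvd M * N" unfolding MN by simp
  then have "P dvd M \<or> P dvd N" using prime by (simp add: prime_elem_dvd_mult_iff)
  then have "is_unit N \<or> is_unit M"
  proof
    assume "P dvd M"
    then have "is_unit N" using dvd[OF MN] no_assoc unfolding M_def by blast
    then show ?thesis ..
  next
    assume "P dvd N"
    then have "is_unit M" using dvd[of N M] MN no_assoc unfolding N_def by (metis mult.commute)
    then show ?thesis ..
  qed
  then show "is_unit h \<or> is_unit k"
    using const[of A B h] const[of C D k] h k h0 unfolding M_def N_def by blast
qed

lemma irreducible_pcompose_translate:
  fixes p :: "'a::field poly"
  assumes "Factorial_Ring.irreducible p"
  shows "Factorial_Ring.irreducible (pcompose p [:a, 1:])"
proof (rule irreducibleI)
  have inv: "pcompose (pcompose q [:a, 1:]) [:-a, 1:] = q" for q :: "'a poly"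
    by (simp flip: pcompose_assoc add: pcompose_pCons)
  have unit: "is_unit (pcompose q [:b, 1:]) \<longleftrightarrow> is_unit q" for q :: "'a poly" and b
    by (cases "q = 0") (auto simp: is_unit_iff_degree pcompose_eq_0_iff degree_pcompose)
  show "pcompose p [:a, 1:] \<noteq> 0" using assms inv[of p] by auto
  show "\<not> is_unit (pcompose p [:a, 1:])"
    unfolding unit using assms by (rule irreducible_not_unit)
  fix u v assume "pcompose p [:a, 1:] = u * v"
  then have "p = pcompose u [:-a, 1:] * pcompose v [:-a, 1:]"
    by (metis inv pcompose_mult)
  then show "is_unit u \<or> is_unit v"
    using assms unit by (metis irreducibleD)
qed

lemma irreducible_quadratic:
  fixes c :: "'a::field"
  assumes "\<not> (\<exists>s. s\<^sup>2 = - c)"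
  shows "Factorial_Ring.irreducible [:c, 0, 1:]"
proof (rule irreducibleI)
  show "[:c, 0, 1:] \<noteq> 0" "\<not> is_unit [:c, 0, 1:]" by (simp_all add: is_unit_iff_degree)
  fix u v :: "'a poly" assume uv: "[:c, 0, 1:] = u * v"
  have nz: "u \<noteq> 0" "v \<noteq> 0" using uv by auto
  have root: False if "degree w = 1" and w_dvd: "w dvd [:c, 0, 1:]" for w :: "'a poly"
  proof -
    obtain a b where w: "w = [:a, b:]" "b \<noteq> 0"
      using degree1_coeffs[OF \<open>degree w = 1\<close>] by blast
    have "poly w (- a / b) = 0" using w by simp
    moreover obtain z where "[:c, 0, 1:] = w * z" using w_dvd by (rule dvdE)
    ultimately have "poly [:c, 0, 1:] (- a / b) = 0" by (metis mult_zero_left poly_mult)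
    then have "(a / b)\<^sup>2 = - c" by (simp add: power2_eq_square eq_neg_iff_add_eq_0 add.commute)
    then show False using assms by blast
  qed
  have "degree u + degree v = 2"
    using arg_cong[OF uv, of degree] nz by (simp add: degree_mult_eq)
  moreover have "degree u \<noteq> 1" using root[of u] uv by auto
  ultimately have "degree u = 0 \<or> degree v = 0" by arith
  then show "is_unit u \<or> is_unit v" using nz by (simp add: is_unit_iff_degree)
qed

section \<open>Valuation rings of a field\<close>

lemma power2_pCons:
  fixes A :: "'a::comm_ring_1 poly"
  shows "(pCons a A)\<^sup>2 = [:a\<^sup>2:] + pCons 0 (smult (2 * a) A) + pCons 0 (pCons 0 (A\<^sup>2))"
proof -
  have "smult (2 * a) A = smult a A + smult a A"
    by (metis mult_2 smult_add_left)
  then show ?thesis by (simp add: power2_eq_square)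
qed

text \<open>
  Squaring is additive modulo 2. The error term is tracked in an arbitrary set \<open>J\<close> closed
  under sums and products, so that both a ring and an ideal of it can be taken for \<open>J\<close>.
\<close>

lemma coeff_square_mod_2:
  fixes J :: "'a::comm_ring_1 set"
  assumes zero: "0 \<in> J" and add: "\<And>x y. x \<in> J \<Longrightarrow> y \<in> J \<Longrightarrow> x + y \<in> J"
    and mult: "\<And>x y. x \<in> J \<Longrightarrow> y \<in> J \<Longrightarrow> x * y \<in> J"
    and A: "\<And>i. coeff A i \<in> J"
  shows "\<exists>r\<in>J. coeff (A\<^sup>2) n = (if even n then (coeff A (n div 2))\<^sup>2 else 0) + 2 * r"
  using A
proof (induction A arbitrary: n)
  case 0
  then show ?case using zero by (intro bexI[of _ 0]) auto
next
  case (pCons a A)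
  have a: "a \<in> J" using pCons.prems[of 0] by simp
  have A: "coeff A i \<in> J" for i using pCons.prems[of "Suc i"] by simp
  note sq = power2_pCons[of a A]
  consider "n = 0" | "n = 1" | k where "n = Suc (Suc k)"
    by (metis One_nat_def not0_implies_Suc)
  then show ?case
  proof cases
    case 1
    then show ?thesis unfolding sq using zero by (intro bexI[of _ 0]) auto
  next
    case 2
    then show ?thesis unfolding sq using mult[OF a A[of 0]]
      by (intro bexI[of _ "a * coeff A 0"]) (auto simp: mult.assoc)
  next
    case 3
    obtain r where r: "r \<in> J" "coeff (A\<^sup>2) k = (if even k then (coeff A (k div 2))\<^sup>2 else 0) + 2 * r"
      using pCons.IH[OF A] by blast
    have "coeff ((pCons a A)\<^sup>2) n = (if even n then (coeff (pCons a A) (n div 2))\<^sup>2 else 0)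
             + 2 * (r + a * coeff A (Suc k))"
      unfolding sq 3 using r(2) by (simp add: algebra_simps)
    then show ?thesis using add[OF r(1) mult[OF a A]] by blast
  qed
qed

locale valuation_subring =
  fixes V :: "'a::field set"
  assumes one_mem: "1 \<in> V"
    and diff_mem: "x \<in> V \<Longrightarrow> y \<in> V \<Longrightarrow> x - y \<in> V"
    and mult_mem: "x \<in> V \<Longrightarrow> y \<in> V \<Longrightarrow> x * y \<in> V"
    and mem_or_inverse_mem: "x \<in> V \<or> inverse x \<in> V"
begin

text \<open>
  An element whose inverse lies outside \<open>V\<close> is itself in \<open>V\<close>, so these are exactly the
  non-units of \<open>V\<close>; the case of \<open>0\<close> is separate because \<open>inverse 0 = 0\<close>.
\<close>

definition maximal_ideal :: "'a set" where
  "maximal_ideal = {x. x = 0 \<or> inverse x \<notin> V}"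

lemma zero_mem: "0 \<in> V" using diff_mem[OF one_mem one_mem] by simp
lemma uminus_mem: "x \<in> V \<Longrightarrow> - x \<in> V" using diff_mem[OF zero_mem] by force
lemma add_mem: "x \<in> V \<Longrightarrow> y \<in> V \<Longrightarrow> x + y \<in> V"
  using diff_mem[of x "- y"] uminus_mem by force
lemma power_mem: "x \<in> V \<Longrightarrow> x ^ n \<in> V"
  by (induction n) (auto intro: one_mem mult_mem)
lemma sum_mem: "(\<And>i. i \<in> I \<Longrightarrow> f i \<in> V) \<Longrightarrow> sum f I \<in> V"
  by (induction I rule: infinite_finite_induct) (auto intro: zero_mem add_mem)
lemma of_nat_mem: "of_nat n \<in> V"
  by (induction n) (auto intro: zero_mem one_mem add_mem)
lemma of_int_mem: "of_int n \<in> V"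
  by (cases n) (auto intro: of_nat_mem uminus_mem diff_mem one_mem simp del: of_nat_Suc)

lemma maximal_ideal_subset: "x \<in> maximal_ideal \<Longrightarrow> x \<in> V"
  using mem_or_inverse_mem[of x] zero_mem unfolding maximal_ideal_def by auto

lemma zero_mem_maximal: "0 \<in> maximal_ideal"
  unfolding maximal_ideal_def by simp

lemma one_notin_maximal: "1 \<notin> maximal_ideal"
  unfolding maximal_ideal_def using one_mem by simp

lemma inverse_mem: "x \<notin> maximal_ideal \<Longrightarrow> inverse x \<in> V"
  unfolding maximal_ideal_def by simp

lemma notin_imp_inverse_maximal: "x \<notin> V \<Longrightarrow> inverse x \<in> maximal_ideal"
  unfolding maximal_ideal_def by simp

lemma mult_mem_maximal:
  assumes "x \<in> maximal_ideal" "y \<in> V"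
  shows "x * y \<in> maximal_ideal"
proof (rule ccontr)
  assume "x * y \<notin> maximal_ideal"
  then have "x * y \<noteq> 0" "inverse (x * y) \<in> V" unfolding maximal_ideal_def by auto
  then have "y * inverse (x * y) \<in> V" using assms mult_mem by blast
  then have "inverse x \<in> V" using \<open>x * y \<noteq> 0\<close> by (simp add: field_simps)
  then show False using assms \<open>x * y \<noteq> 0\<close> unfolding maximal_ideal_def by simp
qed

lemma mult_mem_maximal': "x \<in> V \<Longrightarrow> y \<in> maximal_ideal \<Longrightarrow> x * y \<in> maximal_ideal"
  using mult_mem_maximal[of y x] by (simp add: mult.commute)

lemma add_mem_maximal:
  assumes "x \<in> maximal_ideal" "y \<in> maximal_ideal"
  shows "x + y \<in> maximal_ideal"
proof (cases "x = 0 \<or> y = 0")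
  case True
  then show ?thesis using assms by auto
next
  case False
  consider "x / y \<in> V" | "y / x \<in> V"
    using mem_or_inverse_mem[of "x / y"] by auto
  then show ?thesis
  proof cases
    case 1
    then have "y * (x / y + 1) \<in> maximal_ideal"
      using assms by (intro mult_mem_maximal add_mem one_mem)
    then show ?thesis using False by (simp add: field_simps)
  next
    case 2
    then have "x * (1 + y / x) \<in> maximal_ideal"
      using assms by (intro mult_mem_maximal add_mem one_mem)
    then show ?thesis using False by (simp add: field_simps)
  qed
qed

lemma uminus_mem_maximal: "x \<in> maximal_ideal \<Longrightarrow> - x \<in> maximal_ideal"
  using mult_mem_maximal[of x "- 1"] uminus_mem[OF one_mem] by simp

lemma diff_mem_maximal:
  "x \<in> maximal_ideal \<Longrightarrow> y \<in> maximal_ideal \<Longrightarrow> x - y \<in> maximal_ideal"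
  using add_mem_maximal[of x "- y"] uminus_mem_maximal by simp

lemma sum_mem_maximal: "(\<And>i. i \<in> I \<Longrightarrow> f i \<in> maximal_ideal) \<Longrightarrow> sum f I \<in> maximal_ideal"
  by (induction I rule: infinite_finite_induct) (auto intro: zero_mem_maximal add_mem_maximal)

lemma maximal_prime:
  assumes "x * y \<in> maximal_ideal"
  shows "x \<in> maximal_ideal \<or> y \<in> maximal_ideal"
proof (rule ccontr)
  assume "\<not> ?thesis"
  then have "x \<noteq> 0" "y \<noteq> 0" "inverse x \<in> V" "inverse y \<in> V" unfolding maximal_ideal_def by auto
  then have "inverse (x * y) \<in> V" "x * y \<noteq> 0" using mult_mem by auto
  then show False using assms unfolding maximal_ideal_def by auto
qed

lemma square_mem_maximal: "x\<^sup>2 \<in> maximal_ideal \<Longrightarrow> x \<in> maximal_ideal"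
  using maximal_prime[of x x] by (auto simp: power2_eq_square)

lemma square_mem: assumes "x\<^sup>2 \<in> V" shows "x \<in> V"
proof (rule ccontr)
  assume "x \<notin> V"
  then have "x \<noteq> 0" using zero_mem by auto
  have "inverse x \<in> maximal_ideal" using \<open>x \<notin> V\<close> by (rule notin_imp_inverse_maximal)
  then have "inverse x * (inverse x * x\<^sup>2) \<in> maximal_ideal"
    using assms maximal_ideal_subset by (intro mult_mem_maximal mult_mem) auto
  then show False using one_notin_maximal \<open>x \<noteq> 0\<close> by (simp add: power2_eq_square field_simps)
qed

lemma coeff_mult_mem:
  assumes "\<And>i. coeff p i \<in> V" "\<And>i. coeff q i \<in> V"
  shows "coeff (p * q) n \<in> V"
  unfolding coeff_mult by (intro sum_mem mult_mem assms)

lemma coeff_pcompose_mem: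
  assumes "\<And>i. coeff p i \<in> V" "\<And>i. coeff q i \<in> V"
  shows "coeff (pcompose p q) n \<in> V"
  using assms(1)
proof (induction p arbitrary: n)
  case 0
  then show ?case using zero_mem by simp
next
  case (pCons a p)
  have a: "a \<in> V" using pCons.prems[of 0] by simp
  have p: "coeff p i \<in> V" for i using pCons.prems[of "Suc i"] by simp
  have "coeff [:a:] n \<in> V" using a zero_mem by (auto simp: coeff_pCons split: nat.split)
  then show ?case
    unfolding pcompose_pCons coeff_add
    by (rule add_mem) (rule coeff_mult_mem[OF assms(2) pCons.IH[OF p]])
qed

lemma coeff_mult_mem_maximal:
  assumes "\<And>i. coeff p i \<in> V" "\<And>i. coeff q i \<in> maximal_ideal"
  shows "coeff (p * q) n \<in> maximal_ideal"
  unfolding coeff_mult by (intro sum_mem_maximal mult_mem_maximal' assms)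

text \<open>
  Any two nonzero elements are comparable for divisibility in \<open>V\<close>, so a finite set has an
  element that divides all others.
\<close>

lemma obtain_dominating:
  assumes "finite S" "S \<noteq> {}" "0 \<notin> S"
  obtains a where "a \<in> S" "\<And>x. x \<in> S \<Longrightarrow> x / a \<in> V"
proof -
  have "\<exists>a\<in>S. \<forall>x\<in>S. x / a \<in> V"
    using assms
  proof (induction S rule: finite_ne_induct)
    case (singleton x)
    then show ?case using one_mem by simp
  next
    case (insert y S)
    then obtain a where a: "a \<in> S" "\<forall>x\<in>S. x / a \<in> V" by auto
    have nz: "a \<noteq> 0" "y \<noteq> 0" using insert.prems a by auto
    show ?case
    proof (cases "y / a \<in> V")
      case True
      then show ?thesis using a by blast
    next
      case False
      then have "a / y \<in> V" using mem_or_inverse_mem[of "y / a"] by simp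
      then have "x / y \<in> V" if "x \<in> S" for x
        using mult_mem[of "x / a" "a / y"] a that nz by simp
      then show ?thesis using one_mem nz by auto
    qed
  qed
  then show thesis using that by blast
qed

section \<open>A square plus a unit is not a norm\<close>

context
  assumes two: "2 \<in> maximal_ideal"
begin

text \<open>
  A form of Gauss's lemma. Divide \<open>A\<close> and \<open>B\<close> by a coefficient \<open>a\<close> that divides all the
  others; some coefficient becomes 1. If \<open>a\<close> were not in \<open>V\<close>, the norm would become \<open>0\<close> in the
  residue field, which has characteristic 2. There the coefficients of \<open>A\<^sup>2 - t B\<^sup>2\<close> are, up to
  sign, the squares of the coefficients of \<open>A\<close> in even and those of \<open>B\<close> in odd degree, so all of
  them would vanish.
\<close>

lemma norm_form_coeffs_mem:
  assumes P: "\<And>n. coeff (A\<^sup>2 - [:0, 1:] * B\<^sup>2) n \<in> V"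
  shows "coeff A n \<in> V" "coeff B n \<in> V"
proof -
  define S where "S = ((\<lambda>i. coeff A i) ` {..degree A} \<union> (\<lambda>i. coeff B i) ` {..degree B}) - {0}"
  have S: "coeff A i \<in> insert 0 S" "coeff B i \<in> insert 0 S" for i
    unfolding S_def by (auto simp: le_degree)
  have "coeff A n \<in> V \<and> coeff B n \<in> V"
  proof (cases "S = {}")
    case True
    then show ?thesis using S[of n] zero_mem by auto
  next
    case False
    then obtain a where a: "a \<in> S" "\<And>x. x \<in> S \<Longrightarrow> x / a \<in> V"
      using obtain_dominating[of S] unfolding S_def by auto
    have a0: "a \<noteq> 0" using a unfolding S_def by auto
    define A' B' where "A' = smult (inverse a) A" and "B' = smult (inverse a) B"
    have A': "coeff A' i \<in> V" and B': "coeff B' i \<in> V" for i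
      using S[of i] a(2)[of "coeff A i"] a(2)[of "coeff B i"] zero_mem
      unfolding A'_def B'_def by (auto simp: field_simps)
    have "a \<in> V"
    proof (rule ccontr)
      assume "a \<notin> V"
      then have ia: "inverse a \<in> maximal_ideal" by (rule notin_imp_inverse_maximal)
      have norm': "A'\<^sup>2 - [:0, 1:] * B'\<^sup>2 = smult ((inverse a)\<^sup>2) (A\<^sup>2 - [:0, 1:] * B\<^sup>2)"
        unfolding A'_def B'_def by (simp add: power2_eq_square smult_diff_right)
      have small: "coeff (A'\<^sup>2 - [:0, 1:] * B'\<^sup>2) i \<in> maximal_ideal" for i
        unfolding norm' coeff_smult power2_eq_square[of "inverse a"]
        using ia maximal_ideal_subset P by (intro mult_mem_maximal) auto
      have "coeff A' i \<in> maximal_ideal" for i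
      proof (rule square_mem_maximal)
        obtain r where r: "r \<in> V" "coeff (A'\<^sup>2) (2 * i) = (coeff A' i)\<^sup>2 + 2 * r"
          using coeff_square_mod_2[of V A' "2 * i"] zero_mem add_mem mult_mem A' by auto
        obtain t where t: "t \<in> V" "coeff ([:0, 1:] * B'\<^sup>2) (2 * i) = 2 * t"
        proof (cases i)
          case 0
          then show ?thesis using that[of 0] zero_mem by simp
        next
          case (Suc j)
          then show ?thesis
            using that coeff_square_mod_2[of V B' "Suc (2 * j)"] zero_mem add_mem mult_mem B' by auto
        qed
        have "(coeff A' i)\<^sup>2 = coeff (A'\<^sup>2 - [:0, 1:] * B'\<^sup>2) (2 * i) + 2 * (t - r)"
          using r(2) t(2) by (simp add: algebra_simps)
        also have "\<dots> \<in> maximal_ideal"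
          using r(1) t(1) two by (intro add_mem_maximal mult_mem_maximal diff_mem small)
        finally show "(coeff A' i)\<^sup>2 \<in> maximal_ideal" .
      qed
      moreover have "coeff B' i \<in> maximal_ideal" for i
      proof (rule square_mem_maximal)
        obtain r where r: "r \<in> V" "coeff (A'\<^sup>2) (Suc (2 * i)) = 2 * r"
          using coeff_square_mod_2[of V A' "Suc (2 * i)"] zero_mem add_mem mult_mem A' by auto
        obtain t where t: "t \<in> V" "coeff (B'\<^sup>2) (2 * i) = (coeff B' i)\<^sup>2 + 2 * t"
          using coeff_square_mod_2[of V B' "2 * i"] zero_mem add_mem mult_mem B' by auto
        have "(coeff B' i)\<^sup>2 = 2 * (r - t) - coeff (A'\<^sup>2 - [:0, 1:] * B'\<^sup>2) (Suc (2 * i))"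
          using r(2) t(2) by (simp add: algebra_simps)
        also have "\<dots> \<in> maximal_ideal"
          using r(1) t(1) two by (intro diff_mem_maximal mult_mem_maximal diff_mem small)
        finally show "(coeff B' i)\<^sup>2 \<in> maximal_ideal" .
      qed
      moreover have "(\<exists>i. coeff A' i = 1) \<or> (\<exists>i. coeff B' i = 1)"
      proof -
        obtain i where "a = coeff A i \<or> a = coeff B i" using a(1) unfolding S_def by blast
        then have "coeff A' i = 1 \<or> coeff B' i = 1" using a0 unfolding A'_def B'_def by auto
        then show ?thesis by blast
      qed
      ultimately show False using one_notin_maximal by metis
    qed
    then show ?thesis
      using mult_mem[OF _ A'[of n], of a] mult_mem[OF _ B'[of n], of a] a0
      unfolding A'_def B'_def by (simp flip: mult.assoc)
  qed
  then show "coeff A n \<in> V" "coeff B n \<in> V" by auto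
qed

text \<open>
  Suppose \<open>Q\<^sup>2 + c = A\<^sup>2 - t B\<^sup>2\<close>. With \<open>C = A - Q\<close> the equation becomes
  \<open>C\<^sup>2 + 2 Q C = t B\<^sup>2 + c\<close>. Modulo 2 only squares of single coefficients remain on both sides,
  in even degree on the left and in odd degree, apart from \<open>c\<close>, on the right. Hence all
  coefficients of \<open>B\<close> and all but the constant coefficient \<open>c\<^sub>0\<close> of \<open>C\<close> have squares divisible by
  2. Since 2 is not a unit times a square, these squares are divisible by 2 with a
  non-unit quotient. So modulo \<open>2 \<mm>\<close>, where \<open>\<mm>\<close> is the maximal ideal, \<open>C\<^sup>2\<close> reduces to
  the constant \<open>c\<^sub>0\<^sup>2\<close> and \<open>t B\<^sup>2\<close> vanishes. The coefficient of degree \<open>deg Q\<close> in \<open>2 Q C\<close>, which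
  is \<open>2 c\<^sub>0\<close> because \<open>Q\<close> is monic, therefore vanishes modulo \<open>2 \<mm>\<close>, and \<open>c\<^sub>0\<close> is a non-unit. But the
  constant terms give \<open>c = c\<^sub>0 (c\<^sub>0 + 2 q\<^sub>0)\<close>, and \<open>c\<close> is a unit.
\<close>

theorem square_plus_unit_not_norm_form:
  assumes two_not_square: "\<And>\<beta>. \<beta>\<^sup>2 / 2 \<in> V \<Longrightarrow> \<beta>\<^sup>2 / 2 \<in> maximal_ideal" and two0: "(2::'a) \<noteq> 0"
    and Q: "\<And>i. coeff Q i \<in> V" "lead_coeff Q = 1" "degree Q > 0"
    and c: "c \<in> V" "c \<notin> maximal_ideal"
  shows "Q\<^sup>2 + [:c:] \<noteq> A\<^sup>2 - [:0, 1:] * B\<^sup>2"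
proof
  assume eq: "Q\<^sup>2 + [:c:] = A\<^sup>2 - [:0, 1:] * B\<^sup>2"
  have "coeff (A\<^sup>2 - [:0, 1:] * B\<^sup>2) i \<in> V" for i
    unfolding eq[symmetric] unfolding power2_eq_square
    using coeff_mult_mem[OF Q(1) Q(1), of i] c zero_mem
    by (auto simp: coeff_pCons split: nat.split intro!: add_mem)
  note AB = norm_form_coeffs_mem[OF this]
  define C where "C = A - Q"
  have C: "coeff C i \<in> V" for i unfolding C_def using AB Q by (auto intro: diff_mem)
  have eqC: "C\<^sup>2 + smult 2 (Q * C) = [:0, 1:] * B\<^sup>2 + [:c:]"
  proof -
    have "smult 2 (Q * C) = Q * C + Q * C"
      by (metis one_add_one smult_1_left smult_add_left)
    moreover have "A = Q + C" unfolding C_def by simp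
    ultimately have "C\<^sup>2 + smult 2 (Q * C) = A\<^sup>2 - Q\<^sup>2"
      by (simp add: power2_eq_square algebra_simps)
    also have "\<dots> = [:0, 1:] * B\<^sup>2 + [:c:]"
      using eq by (simp only: algebra_simps)
    finally show ?thesis .
  qed
  have QC: "coeff (Q * C) n \<in> V" for n using Q(1) C by (rule coeff_mult_mem)
  have squareC: "\<exists>r\<in>V. coeff (C\<^sup>2) n = (if even n then (coeff C (n div 2))\<^sup>2 else 0) + 2 * r" for n
    using coeff_square_mod_2[of V C n] zero_mem add_mem mult_mem C by auto
  have squareB: "\<exists>r\<in>V. coeff (B\<^sup>2) n = (if even n then (coeff B (n div 2))\<^sup>2 else 0) + 2 * r" for n
    using coeff_square_mod_2[of V B n] zero_mem add_mem mult_mem AB by auto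
  \<comment> \<open>Degree \<open>2 i + 2\<close>.\<close>
  have C_half: "(coeff C (Suc i))\<^sup>2 / 2 \<in> maximal_ideal" for i
  proof (rule two_not_square)
    obtain r where r: "r \<in> V" "coeff (C\<^sup>2) (Suc (Suc (2 * i))) = (coeff C (Suc i))\<^sup>2 + 2 * r"
      using squareC[of "Suc (Suc (2 * i))"] by auto
    obtain t where t: "t \<in> V" "coeff (B\<^sup>2) (Suc (2 * i)) = 2 * t"
      using squareB[of "Suc (2 * i)"] by auto
    have "(coeff C (Suc i))\<^sup>2 / 2 = t - r - coeff (Q * C) (Suc (Suc (2 * i)))"
      using arg_cong[OF eqC, of "\<lambda>p. coeff p (Suc (Suc (2 * i)))"] r(2) t(2) two0
      by (simp add: field_simps)
    also have "\<dots> \<in> V" using r(1) t(1) QC by (intro diff_mem)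
    finally show "(coeff C (Suc i))\<^sup>2 / 2 \<in> V" .
  qed
  \<comment> \<open>Degree \<open>2 i + 1\<close>.\<close>
  have B_half: "(coeff B i)\<^sup>2 / 2 \<in> maximal_ideal" for i
  proof (rule two_not_square)
    obtain r where r: "r \<in> V" "coeff (C\<^sup>2) (Suc (2 * i)) = 2 * r"
      using squareC[of "Suc (2 * i)"] by auto
    obtain t where t: "t \<in> V" "coeff (B\<^sup>2) (2 * i) = (coeff B i)\<^sup>2 + 2 * t"
      using squareB[of "2 * i"] by auto
    have "(coeff B i)\<^sup>2 / 2 = r - t + coeff (Q * C) (Suc (2 * i))"
      using arg_cong[OF eqC, of "\<lambda>p. coeff p (Suc (2 * i))"] r(2) t(2) two0
      by (simp add: field_simps)
    also have "\<dots> \<in> V" using r(1) t(1) QC by (intro diff_mem add_mem)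
    finally show "(coeff B i)\<^sup>2 / 2 \<in> V" .
  qed
  have small_if_half: "x \<in> maximal_ideal" if "x\<^sup>2 / 2 \<in> maximal_ideal" for x
    using mult_mem_maximal[OF that maximal_ideal_subset[OF two]] two0 by (simp add: square_mem_maximal)
  obtain c0 C' where C_eq: "C = pCons c0 C'" by (cases C) auto
  have C'm: "coeff C' i \<in> maximal_ideal" for i
    using small_if_half[OF C_half[of i]] unfolding C_eq by simp
  have Bm: "coeff B i \<in> maximal_ideal" for i using small_if_half[OF B_half] .
  have c0V: "c0 \<in> V" using C[of 0] unfolding C_eq by simp
  have c0: "c0 \<notin> maximal_ideal"
  proof
    assume c0m: "c0 \<in> maximal_ideal"
    have "c0 * c0 + 2 * (coeff Q 0 * c0) = c"
      using arg_cong[OF eqC, of "\<lambda>p. coeff p 0"] unfolding C_eq power2_eq_square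
      by (simp add: coeff_mult mult.commute)
    moreover have "c0 * c0 + 2 * (coeff Q 0 * c0) \<in> maximal_ideal"
      by (intro add_mem_maximal mult_mem_maximal[OF c0m c0V] mult_mem_maximal[OF two]
          mult_mem Q(1) c0V)
    ultimately show False using c(2) by simp
  qed
  have half_sq: "coeff (D\<^sup>2) n / 2 \<in> maximal_ideal"
    if "\<And>i. coeff D i \<in> maximal_ideal" "\<And>i. (coeff D i)\<^sup>2 / 2 \<in> maximal_ideal" for D n
  proof -
    have "\<exists>r\<in>maximal_ideal. coeff (D\<^sup>2) n =
        (if even n then (coeff D (n div 2))\<^sup>2 else 0) + 2 * r"
      by (rule coeff_square_mod_2)
        (auto intro: that(1) zero_mem_maximal add_mem_maximal mult_mem_maximal maximal_ideal_subset)
    then obtain r where r: "r \<in> maximal_ideal"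
        "coeff (D\<^sup>2) n = (if even n then (coeff D (n div 2))\<^sup>2 else 0) + 2 * r" ..
    have "coeff (D\<^sup>2) n / 2 = (if even n then (coeff D (n div 2))\<^sup>2 / 2 else 0) + r"
      using r(2) two0 by (simp add: field_simps)
    also have "\<dots> \<in> maximal_ideal"
      using that(2) zero_mem_maximal by (intro add_mem_maximal r(1)) auto
    finally show ?thesis .
  qed
  \<comment> \<open>Compare coefficients in degree \<open>deg Q = d + 1\<close> and divide by 2.\<close>
  obtain d where d: "degree Q = Suc d" using Q(3) by (cases "degree Q") auto
  have C2: "coeff (C\<^sup>2) (Suc d) / 2 - c0 * coeff C' d \<in> maximal_ideal"
  proof (cases d)
    case 0
    then show ?thesis unfolding C_eq power2_pCons using two0 zero_mem_maximal by simp
  next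
    case (Suc k)
    have "coeff (C\<^sup>2) (Suc d) / 2 - c0 * coeff C' d = coeff (C'\<^sup>2) k / 2"
      unfolding C_eq Suc power2_pCons using two0 by (simp add: field_simps)
    also have "\<dots> \<in> maximal_ideal"
      using half_sq[of C' k] C'm C_half unfolding C_eq by simp
    finally show ?thesis .
  qed
  have "coeff (Q * C) (Suc d) = c0 + coeff (Q * C') d"
    using Q(2) unfolding C_eq d by (simp add: mult_pCons_right)
  then have "c0 = coeff (B\<^sup>2) d / 2 - (coeff (C\<^sup>2) (Suc d) / 2 - c0 * coeff C' d)
       - c0 * coeff C' d - coeff (Q * C') d"
    using arg_cong[OF eqC, of "\<lambda>p. coeff p (Suc d)"] two0 by (simp add: field_simps)
  also have "\<dots> \<in> maximal_ideal"
    by (rule diff_mem_maximal[OF diff_mem_maximal[OF diff_mem_maximal[OF half_sq[OF Bm B_half] C2]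
          mult_mem_maximal'[OF c0V C'm]] coeff_mult_mem_maximal[OF Q(1) C'm]])
  finally show False using c0 by blast
qed

end

end

section \<open>Integrality and integer relations in number fields\<close>

text \<open>
  Multiplication by \<open>b\<close> on the span of the \<open>v j\<close> over the integers is given by an integer
  matrix with \<open>b\<close> as an eigenvalue, and the characteristic polynomial of that matrix is monic.
\<close>

lemma algebraic_int_if_stabilizes_int_span:
  fixes v :: "nat \<Rightarrow> 'a::field_char_0" and c :: "nat \<Rightarrow> nat \<Rightarrow> int"
  assumes stable: "\<And>j. j < n \<Longrightarrow> b * v j = (\<Sum>l<n. of_int (c j l) * v l)"
    and nonzero: "k < n" "v k \<noteq> 0"
  shows "algebraic_int b"
proof -
  define M where "M = mat n n (\<lambda>(j, l). c j l)"
  define A where "A = (map_mat of_int M :: 'a mat)"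
  define w where "w = vec n v"
  have M: "M \<in> carrier_mat n n" unfolding M_def by simp
  have A: "A \<in> carrier_mat n n" unfolding A_def using M by simp
  have "A *\<^sub>v w = b \<cdot>\<^sub>v w"
    by (rule eq_vecI)
      (simp_all add: A_def M_def w_def scalar_prod_def stable atLeast0LessThan)
  moreover have "w \<noteq> 0\<^sub>v n"
    using nonzero unfolding w_def by (metis index_vec index_zero_vec(1))
  ultimately have "eigenvalue A b"
    unfolding eigenvalue_def eigenvector_def using A by (intro exI[of _ w]) (simp add: w_def)
  then have "poly (char_poly A) b = 0" using eigenvalue_root_char_poly[OF A] by blast
  moreover have "char_poly A = map_poly of_int (char_poly M)"
    unfolding A_def by (rule of_int_hom.char_poly_hom[OF M])
  moreover have "lead_coeff (char_poly M) = 1"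
    using degree_monic_char_poly[OF M] by simp
  ultimately show ?thesis
    unfolding algebraic_int_altdef_ipoly by auto
qed

lemma algebraic_int_if_stabilizes_powers:
  fixes b x :: "'a::field_char_0"
  assumes n: "n > 0"
    and stable: "\<And>j. j < n \<Longrightarrow> \<exists>p. (\<forall>i\<ge>n. coeff p i = 0) \<and> b * x ^ j = poly (map_poly of_int p) x"
  shows "algebraic_int b"
proof -
  have "\<exists>c. b * x ^ j = (\<Sum>l<n. of_int (c l) * x ^ l)" if "j < n" for j
  proof -
    obtain p where p: "\<forall>i\<ge>n. coeff p i = 0" "b * x ^ j = poly (map_poly of_int p) x"
      using stable[OF \<open>j < n\<close>] by blast
    have "poly (map_poly of_int p) x = (\<Sum>l\<le>degree p. of_int (coeff p l) * x ^ l)"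
      by (simp add: poly_altdef coeff_map_poly)
    also have "\<dots> = (\<Sum>l<n. of_int (coeff p l) * x ^ l)"
      by (rule sum.mono_neutral_cong) (use p(1) in \<open>auto simp: coeff_eq_0 not_less\<close>)
    finally show ?thesis using p(2) by metis
  qed
  then obtain c where "\<And>j. j < n \<Longrightarrow> b * x ^ j = (\<Sum>l<n. of_int (c j l) * x ^ l)"
    by metis
  from algebraic_int_if_stabilizes_int_span[OF this, of 0] n show ?thesis by simp
qed

text \<open>
  The numbers \<open>b k = a\<^sub>d x\<^bsup>d-k\<^esup> + ... + a\<^sub>k\<close> arise when a root \<open>x\<close> is substituted into a possibly
  non-monic polynomial by Horner's scheme. Both \<open>b k\<close> and \<open>b k * x\<close> map the span of
  \<open>1, x, ..., x\<^bsup>n-1\<^esup>\<close> over the integers into itself: for a product \<open>b k * x ^ j\<close> whose degree in \<open>x\<close> looks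
  too large, the equation \<open>b k * x ^ k = - (a\<^sub>0 + ... + a\<^sub>k\<^sub>-\<^sub>1 x\<^bsup>k-1\<^esup>)\<close> lowers it. Taking
  \<open>n\<close> one more than the degree \<open>d\<close> ensures that the span is nonzero in every case.
\<close>

lemma algebraic_int_horner:
  fixes x :: "'a::field_char_0" and p :: "int poly"
  assumes root: "poly (map_poly of_int p) x = 0"
  defines "b \<equiv> \<lambda>k. poly (map_poly of_int (poly_shift k p)) x"
  shows "algebraic_int (b k)" "algebraic_int (b k * x)"
proof -
  define n where "n = Suc (degree p)"
  define ev where "ev = (\<lambda>q. poly (map_poly of_int q) x)"
  have ev_add: "ev (q + r) = ev q + ev r" and ev_mult: "ev (q * r) = ev q * ev r"
    and ev_uminus: "ev (- q) = - ev q" and ev_monom: "ev (monom 1 i) = x ^ i" for q r i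
    unfolding ev_def by (simp_all add: poly_monom of_int_poly_hom.hom_add of_int_poly_hom.hom_mult
      of_int_poly_hom.hom_uminus)
  have split: "p = poly_cutoff k p + monom 1 k * poly_shift k p"
    by (rule poly_eqI) (simp add: coeff_poly_cutoff coeff_monom_mult coeff_poly_shift)
  have in_span: "\<exists>q. (\<forall>i\<ge>n. coeff q i = 0) \<and> b k * x ^ j = ev q" if "j \<le> n" for j
  proof (cases "j < k")
    case True
    have "coeff (monom 1 j * poly_shift k p) i = 0" if "i \<ge> n" for i
      using that True by (auto simp: coeff_monom_mult coeff_poly_shift n_def intro!: coeff_eq_0)
    moreover have "b k * x ^ j = ev (monom 1 j * poly_shift k p)"
      unfolding ev_mult ev_monom b_def by (simp add: ev_def)
    ultimately show ?thesis by blast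
  next
    case False
    have "x ^ k * b k = - ev (poly_cutoff k p)"
      using root arg_cong[OF split, of ev] unfolding ev_add ev_mult ev_monom
      unfolding b_def ev_def by (simp add: eq_neg_iff_add_eq_0 add.commute)
    then have "b k * x ^ j = ev (- (monom 1 (j - k) * poly_cutoff k p))"
      using False power_add[of x "j - k" k] unfolding ev_uminus ev_mult ev_monom
      by (simp add: mult.left_commute[of "b k"] mult.commute[of "b k"] mult.assoc)
    moreover have "coeff (- (monom 1 (j - k) * poly_cutoff k p)) i = 0" if "i \<ge> n" for i
      using that \<open>j \<le> n\<close> False by (auto simp: coeff_monom_mult coeff_poly_cutoff)
    ultimately show ?thesis by blast
  qed
  have n: "n > 0" unfolding n_def by simp
  show "algebraic_int (b k)"
    by (rule algebraic_int_if_stabilizes_powers[OF n, of _ x])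
      (use in_span in \<open>auto simp: ev_def\<close>)
  show "algebraic_int (b k * x)"
    by (rule algebraic_int_if_stabilizes_powers[OF n, of _ x])
      (use in_span[of "Suc _"] in \<open>auto simp: ev_def mult.assoc\<close>)
qed

text \<open>
  Linear dependence over the rationals, with denominators cleared and the greatest common
  divisor of the coefficients divided out: what remains cannot be even throughout.
\<close>

lemma int_relation:
  assumes "number_field TYPE('a::field_char_0)"
  shows "\<exists>d. \<forall>r>d. \<forall>x :: nat \<Rightarrow> 'a. \<exists>n :: nat \<Rightarrow> int.
    (\<exists>i<r. odd (n i)) \<and> (\<Sum>i<r. of_int (n i) * x i) = 0"
proof -
  obtain B :: "'a set" where B: "finite_dimensional_vector_space (\<lambda>(c::rat) x. of_rat c * x) B"
    using assms unfolding number_field_def by blast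
  interpret fd: finite_dimensional_vector_space "\<lambda>(c::rat) (x::'a). of_rat c * x" B by (rule B)
  have "\<exists>n :: nat \<Rightarrow> int. (\<exists>i<r. odd (n i)) \<and> (\<Sum>i<r. of_int (n i) * x i) = 0"
    if r: "r > fd.dimension" for r and x :: "nat \<Rightarrow> 'a"
  proof -
    have "\<exists>q :: nat \<Rightarrow> rat. (\<exists>i<r. q i \<noteq> 0) \<and> (\<Sum>i<r. of_rat (q i) * x i) = 0"
    proof (cases "inj_on x {..<r}")
      case True
      then have "card (x ` {..<r}) > fd.dim (x ` {..<r})"
        using r fd.dim_subset_UNIV[of "x ` {..<r}"] by (simp add: card_image)
      then have "fd.dependent (x ` {..<r})" by (intro fd.dependent_biggerset_general) auto
      then obtain u where u: "\<exists>v\<in>x ` {..<r}. u v \<noteq> 0" "(\<Sum>v\<in>x ` {..<r}. of_rat (u v) * v) = 0"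
        unfolding fd.dependent_finite[OF finite_imageI[OF finite_lessThan]] by blast
      then show ?thesis
        using True by (intro exI[of _ "u \<circ> x"]) (auto simp: sum.reindex)
    next
      case False
      then obtain i j where ij: "i < r" "j < r" "i \<noteq> j" "x i = x j" unfolding inj_on_def by auto
      define q where "q = (\<lambda>k. if k = i then 1 else if k = j then - 1 else 0 :: rat)"
      have "(\<Sum>k<r. of_rat (q k) * x k) = (\<Sum>k\<in>{i, j}. of_rat (q k) * x k)"
        by (rule sum.mono_neutral_right) (use ij in \<open>auto simp: q_def\<close>)
      also have "\<dots> = 0" using ij by (simp add: q_def of_rat_minus)
      finally show ?thesis using ij by (intro exI[of _ q]) (auto simp: q_def)
    qed
    then obtain q :: "nat \<Rightarrow> rat" where q: "\<exists>i<r. q i \<noteq> 0" "(\<Sum>i<r. of_rat (q i) * x i) = 0" by blast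
    define D where "D = (\<Prod>i<r. snd (quotient_of (q i)))"
    have D: "D > 0" unfolding D_def by (intro prod_pos) (simp add: quotient_of_denom_pos')
    have "\<exists>N. of_int D * q i = of_int N" if "i < r" for i
    proof -
      obtain a b where ab: "quotient_of (q i) = (a, b)" by fastforce
      have "b dvd D" unfolding D_def using that ab by (intro dvd_prodI[of "{..<r}" i, THEN dvd_trans[rotated]]) auto
      then obtain e where "D = b * e" ..
      moreover have "b > 0" using quotient_of_denom_pos[OF ab] .
      ultimately have "of_int D * q i = of_int (e * a)"
        unfolding quotient_of_div[OF ab] by simp
      then show ?thesis by blast
    qed
    then obtain N where N: "\<And>i. i < r \<Longrightarrow> of_int D * q i = of_int (N i)" by metis
    have "(\<Sum>i<r. of_int (N i) * x i) = (\<Sum>i<r. of_rat (of_int D) * (of_rat (q i) * x i))"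
    proof (rule sum.cong[OF refl])
      fix i assume "i \<in> {..<r}"
      then have "(of_rat (of_int (N i)) :: 'a) = of_rat (of_int D) * of_rat (q i)"
        using N[of i] by (metis lessThan_iff of_rat_mult)
      then show "of_int (N i) * x i = of_rat (of_int D) * (of_rat (q i) * x i)"
        by (simp add: mult.assoc)
    qed
    also have "\<dots> = 0" unfolding sum_distrib_left[symmetric] q(2) by simp
    finally have N0: "(\<Sum>i<r. of_int (N i) * x i) = 0" .
    define g where "g = Gcd (N ` {..<r})"
    have "g \<noteq> 0"
    proof
      assume "g = 0"
      then have "N i = 0" if "i < r" for i using that unfolding g_def by (auto simp: Gcd_0_iff)
      then show False using q(1) N D by force
    qed
    have "\<exists>n. N i = g * n" if "i < r" for i
    proof -
      have "g dvd N i" unfolding g_def by (rule Gcd_dvd) (use that in blast)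
      then show ?thesis by (auto elim: dvdE)
    qed
    then obtain n where n: "\<And>i. i < r \<Longrightarrow> N i = g * n i" by metis
    have "\<exists>i<r. odd (n i)"
    proof (rule ccontr)
      assume "\<not> ?thesis"
      then have "g * 2 dvd N i" if "i < r" for i using n[OF that] that by (simp add: mult_dvd_mono)
      then have "g * 2 dvd g" unfolding g_def by (intro Gcd_greatest) auto
      then show False using \<open>g \<noteq> 0\<close> by (simp add: dvd_times_left_cancel_iff[of g 2 1, simplified])
    qed
    moreover have "of_int g * (\<Sum>i<r. of_int (n i) * x i) = 0"
      using N0 by (simp add: n sum_distrib_left mult.assoc)
    ultimately show ?thesis using \<open>g \<noteq> 0\<close> by auto
  qed
  then show ?thesis by blast
qed

section \<open>Localisation at a prime above 2\<close>

locale integer_prime =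
  fixes \<qq> :: "'a::field_char_0 set"
  assumes prime: "primeideal \<qq> ring_of_integers"
begin

abbreviation prime_power :: "nat \<Rightarrow> 'a set" where
  "prime_power n \<equiv> \<qq> [^]\<^bsub>ideals_set ring_of_integers\<^esub> n"

text \<open>
  That \<open>\<qq>\<close> is an ideal of a commutative ring contains the closure of the algebraic integers
  under sums and products, which the next lemmas extract.
\<close>

interpretation R: primeideal \<qq> ring_of_integers by (rule prime)

lemma int_add: "algebraic_int x \<Longrightarrow> algebraic_int y \<Longrightarrow> algebraic_int (x + y)" for x y :: 'a
  using R.add.m_closed[of x y] by (simp add: ring_of_integers_def)

lemma int_mult: "algebraic_int x \<Longrightarrow> algebraic_int y \<Longrightarrow> algebraic_int (x * y)" for x y :: 'a
  using R.m_closed[of x y] by (simp add: ring_of_integers_def)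

lemma int_diff: "algebraic_int x \<Longrightarrow> algebraic_int y \<Longrightarrow> algebraic_int (x - y)" for x y :: 'a
  using int_add[of x "- y"] by simp

lemma int_of_int: "algebraic_int (of_int n :: 'a)"
  by (rule int_imp_algebraic_int) simp

lemma int_one: "algebraic_int (1 :: 'a)"
  using int_of_int[of 1] by simp

lemma prime_int: "x \<in> \<qq> \<Longrightarrow> algebraic_int x"
  using R.Icarr[of x] by (simp add: ring_of_integers_def)

lemma prime_zero: "0 \<in> \<qq>"
  using additive_subgroup.zero_closed[OF ideal.axioms(1)[OF R.is_ideal]] by (simp add: ring_of_integers_def)

lemma prime_add: "x \<in> \<qq> \<Longrightarrow> y \<in> \<qq> \<Longrightarrow> x + y \<in> \<qq>"
  using additive_subgroup.a_closed[OF ideal.axioms(1)[OF R.is_ideal], of x y] by (simp add: ring_of_integers_def)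

lemma prime_mult: "algebraic_int x \<Longrightarrow> y \<in> \<qq> \<Longrightarrow> x * y \<in> \<qq>"
  using R.I_l_closed[of y x] by (simp add: ring_of_integers_def)

lemma prime_mult': "x \<in> \<qq> \<Longrightarrow> algebraic_int y \<Longrightarrow> x * y \<in> \<qq>"
  using prime_mult[of y x] by (simp add: mult.commute)

lemma prime_diff: "x \<in> \<qq> \<Longrightarrow> y \<in> \<qq> \<Longrightarrow> x - y \<in> \<qq>"
  using prime_add[of x "- 1 * y"] prime_mult[of "- 1" y] int_one by simp

lemma prime_cases:
  "x * y \<in> \<qq> \<Longrightarrow> algebraic_int x \<Longrightarrow> algebraic_int y \<Longrightarrow> x \<in> \<qq> \<or> y \<in> \<qq>"
  using R.I_prime[of x y] by (simp add: ring_of_integers_def)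

lemma one_notin_prime: "1 \<notin> \<qq>"
  using R.one_imp_carrier R.I_notcarr by (auto simp: ring_of_integers_def)

lemma prime_power_0: "prime_power 0 = {x. algebraic_int x}"
  by (simp add: nat_pow_def ideals_set_def ring_of_integers_def)

lemma prime_power_Suc: "prime_power (Suc n) = ideal_prod ring_of_integers (prime_power n) \<qq>"
  by (simp add: nat_pow_def ideals_set_def)

lemma prime_power_ideal: "ideal (prime_power n) ring_of_integers"
proof (induction n)
  case 0
  then show ?case using R.oneideal unfolding prime_power_0 by (simp add: ring_of_integers_def)
next
  case (Suc n)
  then show ?case unfolding prime_power_Suc by (intro R.ideal_prod_is_ideal R.is_ideal)
qed

lemma prime_power_add: "x \<in> prime_power n \<Longrightarrow> y \<in> prime_power n \<Longrightarrow> x + y \<in> prime_power n"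
  using additive_subgroup.a_closed[OF ideal.axioms(1)[OF prime_power_ideal], of x n y]
  by (simp add: ring_of_integers_def)

lemma prime_power_mult: "x \<in> prime_power n \<Longrightarrow> algebraic_int y \<Longrightarrow> x * y \<in> prime_power n"
  using ideal.I_r_closed[OF prime_power_ideal, of x n y] by (simp add: ring_of_integers_def)

lemma power_mem_prime_power: "z \<in> \<qq> \<Longrightarrow> z ^ n \<in> prime_power n"
proof (induction n)
  case 0
  then show ?case unfolding prime_power_0 by (simp add: int_one)
next
  case (Suc n)
  then have "z ^ n \<otimes>\<^bsub>ring_of_integers\<^esub> z \<in> prime_power (Suc n)"
    unfolding prime_power_Suc by (blast intro: ideal_prod.prod)
  moreover have "z ^ n \<otimes>\<^bsub>ring_of_integers\<^esub> z = z ^ Suc n"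
    by (simp add: ring_of_integers_def mult.commute)
  ultimately show ?case by metis
qed

text \<open>
  If 2 lies outside \<open>\<qq>\<close>, then it lies in the zeroth power of \<open>\<qq>\<close> only, and its valuation
  is the even number \<open>0\<close>.
\<close>

lemma two_mem_if_odd_valuation:
  assumes "odd (adic_valuation \<qq> 2)"
  shows "2 \<in> \<qq>"
proof (rule ccontr)
  assume notin: "2 \<notin> \<qq>"
  have "2 \<notin> prime_power (Suc n)" for n
    using notin R.ideal_prod_inter[OF prime_power_ideal[of n] R.is_ideal]
    unfolding prime_power_Suc by blast
  moreover have "2 \<in> prime_power 0"
    using int_of_int[of 2] unfolding prime_power_0 by simp
  ultimately have "adic_valuation \<qq> 2 = 0"
    unfolding adic_valuation_def
    by (intro Greatest_equality) (metis not0_implies_Suc le_refl)+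
  then show False using assms by simp
qed

end

locale prime_above_two = integer_prime +
  assumes number_field: "number_field TYPE('a)"
    and two_mem: "2 \<in> \<qq>"
begin

lemma odd_notin_prime: "odd n \<Longrightarrow> of_int n \<notin> \<qq>"
proof
  assume "odd n" and n: "of_int n \<in> \<qq>"
  from \<open>odd n\<close> obtain k where k: "n = 2 * k + 1" by (rule oddE)
  have "of_int n - of_int k * 2 \<in> \<qq>"
    using n two_mem by (intro prime_diff prime_mult int_of_int)
  then show False using one_notin_prime unfolding k by simp
qed

lemma even_mem_prime: "even n \<Longrightarrow> of_int n \<in> \<qq>"
  using two_mem by (auto elim!: evenE intro!: prime_mult' int_of_int)

lemma eval_pCons:
  "poly (map_poly of_int (pCons a p)) x = of_int a + x * poly (map_poly of_int p) x" for x :: 'a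
  by (cases "a = 0 \<and> p = 0") (auto simp: map_poly_pCons)

text \<open>
  The ideal \<open>\<qq>\<close> is maximal. Reduced modulo \<open>\<qq>\<close>, an integer polynomial has coefficients 0 and
  1. Starting from an integral equation for \<open>b\<close>, even constant coefficients are dropped and \<open>b\<close>,
  being nonzero modulo \<open>\<qq>\<close>, is cancelled until an odd constant coefficient appears; this
  exhibits 1 as a multiple of \<open>b\<close>.
\<close>

lemma inverse_mod_prime:
  assumes b: "algebraic_int b" "b \<notin> \<qq>"
  obtains u where "algebraic_int u" "1 - b * u \<in> \<qq>"
proof -
  have ev_int: "algebraic_int (poly (map_poly of_int p) b)" for p
    by (induction p) (auto simp: eval_pCons intro: int_add int_mult int_of_int b)
  have "\<exists>u. algebraic_int u \<and> 1 - b * u \<in> \<qq>"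
    if "poly (map_poly of_int p) b \<in> \<qq>" "odd (lead_coeff p)" for p :: "int poly"
    using that
  proof (induction p)
    case (pCons a p)
    have val: "of_int a + b * poly (map_poly of_int p) b \<in> \<qq>"
      using pCons.prems(1) by (simp add: eval_pCons)
    show ?case
    proof (cases "even a")
      case True
      then have p0: "p \<noteq> 0" using pCons.prems(2) by auto
      have "b * poly (map_poly of_int p) b \<in> \<qq>"
        using prime_diff[OF val even_mem_prime[OF True]] by simp
      then have "poly (map_poly of_int p) b \<in> \<qq>"
        using prime_cases b ev_int by blast
      then show ?thesis using pCons.IH pCons.prems(2) p0 by simp
    next
      case False
      then have "of_int (1 - a) + (of_int a + b * poly (map_poly of_int p) b) \<in> \<qq>"
        by (intro prime_add val even_mem_prime) simp
      then have "1 - b * (- poly (map_poly of_int p) b) \<in> \<qq>" by (simp add: algebra_simps)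
      then show ?thesis using ev_int[of p] by (metis algebraic_int_minus)
    qed
  qed simp
  moreover obtain p where "poly (map_poly of_int p) b = 0" "lead_coeff p = 1"
    using b(1) unfolding algebraic_int_altdef_ipoly by blast
  ultimately show thesis using that prime_zero by (metis odd_one)
qed

definition local_ring :: "'a set" where
  "local_ring = {a / b | a b. algebraic_int a \<and> algebraic_int b \<and> b \<notin> \<qq>}"

lemma local_ringI:
  "algebraic_int a \<Longrightarrow> algebraic_int b \<Longrightarrow> b \<notin> \<qq> \<Longrightarrow> x = a / b \<Longrightarrow> x \<in> local_ring"
  unfolding local_ring_def by blast

lemma local_ringE:
  assumes "x \<in> local_ring"
  obtains a b where "algebraic_int a" "algebraic_int b" "b \<notin> \<qq>" "b \<noteq> 0" "x = a / b"
  using assms prime_zero unfolding local_ring_def by blast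

lemma int_local: "algebraic_int x \<Longrightarrow> x \<in> local_ring"
  by (rule local_ringI[of x 1]) (auto simp: one_notin_prime int_one)

text \<open>
  The localisation at \<open>\<qq>\<close> is a valuation ring. Take an integer polynomial with root \<open>x\<close> and an
  odd coefficient \<open>a\<^sub>k\<close>, and let \<open>b k\<close> be the numbers from Horner's scheme. As
  \<open>b k - b (k + 1) * x = a\<^sub>k\<close> is not in \<open>\<qq>\<close>, one of the integers \<open>b k\<close>, \<open>b (k + 1) * x\<close> is not in
  \<open>\<qq>\<close>. It can serve as the denominator of \<open>x = (b k * x) / b k\<close> in the first case, and of
  \<open>inverse x = b (k + 1) / (b (k + 1) * x)\<close> in the second.
\<close>

lemma local_or_inverse_local: "x \<in> local_ring \<or> inverse x \<in> local_ring"
proof -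
  obtain d where d: "\<forall>r>d. \<forall>x :: nat \<Rightarrow> 'a. \<exists>n :: nat \<Rightarrow> int.
      (\<exists>i<r. odd (n i)) \<and> (\<Sum>i<r. of_int (n i) * x i) = 0"
    using int_relation[OF number_field] by blast
  obtain n k where n: "k < Suc d" "odd (n k)" "(\<Sum>i<Suc d. of_int (n i) * x ^ i) = 0"
    using d[rule_format, of "Suc d" "\<lambda>i. x ^ i"] by auto
  define p where "p = (\<Sum>i<Suc d. monom (n i) i)"
  have coeff_p: "coeff p i = (if i < Suc d then n i else 0)" for i
    unfolding p_def coeff_sum by (simp add: sum.delta)
  have root: "poly (map_poly of_int p) x = 0"
    using n(3) by (simp only: p_def of_int_poly_hom.hom_sum poly_sum poly_monom
        of_int_hom.map_poly_hom_monom)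
  define b where "b = (\<lambda>k. poly (map_poly of_int (poly_shift k p)) x)"
  have b_int: "algebraic_int (b i)" "algebraic_int (b i * x)" for i
    unfolding b_def using algebraic_int_horner[OF root] by blast+
  have "poly_shift k p = pCons (coeff p k) (poly_shift (Suc k) p)"
    by (rule poly_eqI) (simp add: coeff_poly_shift coeff_pCons split: nat.split)
  then have "b k - b (Suc k) * x = of_int (n k)"
    using n(1) unfolding b_def by (simp add: eval_pCons coeff_p)
  then have "b k - b (Suc k) * x \<notin> \<qq>" using odd_notin_prime[OF n(2)] by simp
  then consider "b k \<notin> \<qq>" | "b (Suc k) * x \<notin> \<qq>" using prime_diff by blast
  then show ?thesis
  proof cases
    case 1
    then have "b k \<noteq> 0" using prime_zero by auto
    then have "x = b k * x / b k" by simp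
    then show ?thesis using 1 b_int local_ringI by blast
  next
    case 2
    then have "b (Suc k) * x \<noteq> 0" using prime_zero by auto
    then have "inverse x = b (Suc k) / (b (Suc k) * x)" by (simp add: field_simps)
    then show ?thesis using 2 b_int local_ringI by blast
  qed
qed

sublocale valuation_subring local_ring
proof
  show "1 \<in> local_ring" using int_local int_one by blast
  show "x \<in> local_ring \<or> inverse x \<in> local_ring" for x by (rule local_or_inverse_local)
  fix x y assume "x \<in> local_ring" "y \<in> local_ring"
  then obtain a b c d where x: "algebraic_int a" "algebraic_int b" "b \<notin> \<qq>" "b \<noteq> 0" "x = a / b"
    and y: "algebraic_int c" "algebraic_int d" "d \<notin> \<qq>" "d \<noteq> 0" "y = c / d"
    by (metis local_ringE)
  have bd: "algebraic_int (b * d)" "b * d \<notin> \<qq>" using x y int_mult prime_cases by blast+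
  show "x - y \<in> local_ring"
    by (rule local_ringI[of "a * d - c * b" "b * d"])
      (use x y bd in \<open>auto intro: int_diff int_mult simp: field_simps\<close>)
  show "x * y \<in> local_ring"
    by (rule local_ringI[of "a * c" "b * d"]) (use x y bd in \<open>auto intro: int_mult\<close>)
qed

lemma int_mem_maximal_iff:
  assumes a: "algebraic_int a"
  shows "a \<in> maximal_ideal \<longleftrightarrow> a \<in> \<qq>"
proof
  assume m: "a \<in> maximal_ideal"
  show "a \<in> \<qq>"
  proof (rule ccontr)
    assume "a \<notin> \<qq>"
    then have "a \<noteq> 0" "inverse a \<in> local_ring"
      using prime_zero local_ringI[of 1 a] a int_one by (auto simp: field_simps)
    then show False using m unfolding maximal_ideal_def by blast
  qed
next
  assume q: "a \<in> \<qq>"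
  show "a \<in> maximal_ideal"
  proof (rule ccontr)
    assume "a \<notin> maximal_ideal"
    then have "a \<noteq> 0" "inverse a \<in> local_ring" unfolding maximal_ideal_def by auto
    then obtain c d where cd: "algebraic_int c" "d \<notin> \<qq>" "d \<noteq> 0" "inverse a = c / d"
      using local_ringE by metis
    then have "d = c * a" using \<open>a \<noteq> 0\<close> by (simp add: field_simps)
    then show False using prime_mult cd q by blast
  qed
qed

lemma two_mem_maximal: "2 \<in> maximal_ideal"
  using int_mem_maximal_iff[OF prime_int[OF two_mem]] two_mem by simp

lemma odd_notin_maximal: "odd n \<Longrightarrow> of_int n \<notin> maximal_ideal"
  using int_mem_maximal_iff[OF int_of_int] odd_notin_prime by blast

text \<open>
  A strictly ascending chain of principal ideals of the localisation that starts strictly above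
  the ideal generated by 2.
\<close>

definition divisor_chain :: "nat \<Rightarrow> (nat \<Rightarrow> 'a) \<Rightarrow> bool" where
  "divisor_chain r x \<longleftrightarrow>
     (\<forall>i<r. x i \<in> local_ring \<and> x i \<noteq> 0 \<and> 2 / x i \<in> maximal_ideal) \<and>
     (\<forall>j<r. \<forall>i<j. x i / x j \<in> maximal_ideal)"

text \<open>
  The chain elements are linearly independent modulo 2, so the degree of the number field
  bounds their number. In an integer relation with an odd coefficient, let \<open>k\<close> be the last
  index with odd coefficient: the \<open>k\<close>-th term divides all the others with non-unit quotients,
  the earlier ones by the chain condition and the later ones because they are multiples of 2.
\<close>

lemma divisor_chain_bounded:
  obtains d where "\<And>r x. divisor_chain r x \<Longrightarrow> r \<le> d"
proof -
  obtain d where d: "\<forall>r>d. \<forall>x :: nat \<Rightarrow> 'a. \<exists>n :: nat \<Rightarrow> int.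
      (\<exists>i<r. odd (n i)) \<and> (\<Sum>i<r. of_int (n i) * x i) = 0"
    using int_relation[OF number_field] by blast
  show thesis
  proof (rule that[of d], rule ccontr)
    fix r and x :: "nat \<Rightarrow> 'a"
    assume chain: "divisor_chain r x" and "\<not> r \<le> d"
    have mem: "x i \<in> local_ring" and nz: "x i \<noteq> 0" and two: "2 / x i \<in> maximal_ideal"
      if "i < r" for i
      using chain that unfolding divisor_chain_def by auto
    have ratio: "x i / x j \<in> maximal_ideal" if "i < j" "j < r" for i j
      using chain that unfolding divisor_chain_def by auto
    from \<open>\<not> r \<le> d\<close> obtain n :: "nat \<Rightarrow> int" where n: "\<exists>i<r. odd (n i)" "(\<Sum>i<r. of_int (n i) * x i) = 0"
      using d by (meson not_le)
    define k where "k = Max {i. i < r \<and> odd (n i)}"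
    have fin: "finite {i. i < r \<and> odd (n i)}" by simp
    have k: "k < r" "odd (n k)" using Max_in[OF fin] n(1) unfolding k_def by auto
    have above: "even (n i)" if "k < i" "i < r" for i
      using Max_ge[OF fin, of i] that unfolding k_def[symmetric] by auto
    have "of_int (n k) = - (\<Sum>i\<in>{..<r} - {k}. of_int (n i) * (x i / x k))"
    proof -
      have "of_int (n k) * x k + (\<Sum>i\<in>{..<r} - {k}. of_int (n i) * x i) = 0"
        using n(2) k(1) by (subst (asm) sum.remove[of _ k]) auto
      then have "of_int (n k) * x k = - (\<Sum>i\<in>{..<r} - {k}. of_int (n i) * x i)"
        by (simp add: eq_neg_iff_add_eq_0)
      then have "of_int (n k) = - (\<Sum>i\<in>{..<r} - {k}. of_int (n i) * x i) / x k"
        using nz[OF k(1)] by (simp add: field_simps)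
      then show ?thesis by (simp add: sum_divide_distrib)
    qed
    also have "\<dots> \<in> maximal_ideal"
    proof (intro uminus_mem_maximal sum_mem_maximal)
      fix i assume i: "i \<in> {..<r} - {k}"
      show "of_int (n i) * (x i / x k) \<in> maximal_ideal"
      proof (cases "i < k")
        case True
        then show ?thesis using ratio k(1) of_int_mem by (intro mult_mem_maximal') auto
      next
        case False
        then obtain l where "n i = 2 * l" using above i by (metis DiffE evenE insertI1 lessThan_iff nat_neq_iff)
        then have "of_int (n i) * (x i / x k) = (2 / x k) * (of_int l * x i)" by simp
        also have "\<dots> \<in> maximal_ideal"
          using two k(1) mem i of_int_mem by (intro mult_mem_maximal mult_mem) auto
        finally show ?thesis .
      qed
    qed
    finally show False using odd_notin_maximal k(2) by blast
  qed
qed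

text \<open>
  If no non-unit generated the maximal ideal, then each would have a proper divisor that is
  still a non-unit; starting at 2, this gives arbitrarily long chains of divisors.
\<close>

lemma obtain_uniformizer:
  obtains \<pi> where "\<pi> \<in> \<qq>" "\<pi> \<noteq> 0" "\<And>y. y \<in> maximal_ideal \<Longrightarrow> y / \<pi> \<in> local_ring"
proof -
  have "\<exists>\<pi>\<in>maximal_ideal. \<pi> \<noteq> 0 \<and> (\<forall>y\<in>maximal_ideal. y / \<pi> \<in> local_ring)"
  proof (rule ccontr)
    assume neg: "\<not> ?thesis"
    have "\<exists>y. y \<in> maximal_ideal \<and> y \<noteq> 0 \<and> x / y \<in> maximal_ideal"
      if x: "x \<in> maximal_ideal" "x \<noteq> 0" for x
    proof -
      obtain y where y: "y \<in> maximal_ideal" "y / x \<notin> local_ring" using neg x by blast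
      then have "y \<noteq> 0" "x / y \<in> maximal_ideal"
        using notin_imp_inverse_maximal[of "y / x"] zero_mem by auto
      then show ?thesis using y by blast
    qed
    then obtain next_elt where next_elt: "\<And>x. x \<in> maximal_ideal \<Longrightarrow> x \<noteq> 0 \<Longrightarrow>
        next_elt x \<in> maximal_ideal \<and> next_elt x \<noteq> 0 \<and> x / next_elt x \<in> maximal_ideal"
      by metis
    define x where "x = (\<lambda>i. (next_elt ^^ i) 2)"
    have x: "x i \<in> maximal_ideal" "x i \<noteq> 0" for i
      by (induction i) (use two_mem_maximal next_elt in \<open>auto simp: x_def\<close>)
    have step: "x i / x (Suc i) \<in> maximal_ideal" for i
      using next_elt[OF x[of i]] unfolding x_def by simp
    have ratio: "x i / x j \<in> maximal_ideal" if "i < j" for i j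
      using that
    proof (induction j)
      case (Suc j)
      show ?case
      proof (cases "i = j")
        case False
        then have "x i / x j * (x j / x (Suc j)) \<in> maximal_ideal"
          using Suc step maximal_ideal_subset by (intro mult_mem_maximal) auto
        then show ?thesis using x(2) by simp
      qed (use step in simp)
    qed simp
    obtain d where d: "\<And>r x. divisor_chain r x \<Longrightarrow> r \<le> d"
      using divisor_chain_bounded by blast
    have "2 / x (Suc i) \<in> maximal_ideal" for i
      using ratio[of 0 "Suc i"] by (simp add: x_def)
    then have "divisor_chain (Suc d) (\<lambda>i. x (Suc i))"
      using x ratio maximal_ideal_subset unfolding divisor_chain_def by auto
    then show False using d by fastforce
  qed
  then obtain \<pi> where p: "\<pi> \<in> maximal_ideal" "\<pi> \<noteq> 0" "\<And>y. y \<in> maximal_ideal \<Longrightarrow> y / \<pi> \<in> local_ring"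
    by blast
  obtain a b where ab: "algebraic_int a" "algebraic_int b" "b \<notin> \<qq>" "b \<noteq> 0" "\<pi> = a / b"
    using maximal_ideal_subset[OF p(1)] by (rule local_ringE)
  have "a = \<pi> * b" using ab by simp
  then have "a \<in> maximal_ideal" using p(1) int_local[OF ab(2)] mult_mem_maximal by blast
  then have "a \<in> \<qq>" using int_mem_maximal_iff ab(1) by blast
  moreover have "y / a \<in> local_ring" if "y \<in> maximal_ideal" for y
  proof -
    have "inverse b \<in> local_ring" using ab int_one by (intro local_ringI[of 1 b]) (auto simp: field_simps)
    then have "y / \<pi> * inverse b \<in> local_ring" using p(3)[OF that] mult_mem by blast
    then show ?thesis using ab by (simp add: field_simps)
  qed
  ultimately show thesis using that p(2) ab by auto
qed

text \<open>
  For the direction from right to left, an element \<open>b\<close> outside \<open>\<qq>\<close> with \<open>b * x\<close> in the power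
  of \<open>\<qq>\<close> has to be cancelled. The ideal \<open>\<qq>\<close> being maximal, some \<open>z = 1 - b * u\<close> lies in \<open>\<qq>\<close>, and
  \<open>b\<close> divides \<open>1 - z ^ n\<close>; so \<open>x\<close> is the sum of \<open>z ^ n * x\<close> and a multiple of \<open>b * x\<close>.
\<close>

lemma mem_prime_power_iff:
  assumes \<pi>: "\<pi> \<in> \<qq>" "\<pi> \<noteq> 0" "\<And>y. y \<in> maximal_ideal \<Longrightarrow> y / \<pi> \<in> local_ring"
    and x: "algebraic_int x"
  shows "x \<in> prime_power n \<longleftrightarrow> x / \<pi> ^ n \<in> local_ring"
proof
  show "x / \<pi> ^ n \<in> local_ring" if "x \<in> prime_power n"
    using that
  proof (induction n arbitrary: x)
    case 0
    then show ?case using int_local unfolding prime_power_0 by simp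
  next
    case (Suc n)
    from Suc.prems show ?case unfolding prime_power_Suc
    proof (induction rule: ideal_prod.induct)
      case (prod i j)
      then have "i / \<pi> ^ n * (j / \<pi>) \<in> local_ring"
        using Suc.IH \<pi>(3) int_mem_maximal_iff[OF prime_int] by (intro mult_mem) auto
      then show ?case by (simp add: ring_of_integers_def field_simps)
    next
      case (sum s t)
      then show ?case using add_mem by (simp add: ring_of_integers_def add_divide_distrib)
    qed
  qed
next
  assume "x / \<pi> ^ n \<in> local_ring"
  then obtain a b where ab: "algebraic_int a" "algebraic_int b" "b \<notin> \<qq>" "b \<noteq> 0" "x / \<pi> ^ n = a / b"
    by (rule local_ringE)
  then have bx: "b * x = \<pi> ^ n * a" using \<pi>(2) by (simp add: field_simps)
  obtain u where u: "algebraic_int u" "1 - b * u \<in> \<qq>" using inverse_mod_prime ab by blast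
  define z where "z = 1 - b * u"
  have z: "z \<in> \<qq>" unfolding z_def by (rule u)
  have "\<exists>w. algebraic_int w \<and> 1 - z ^ n = b * w" for n
  proof (induction n)
    case 0
    then show ?case by (intro exI[of _ 0]) auto
  next
    case (Suc n)
    then obtain w where w: "algebraic_int w" "1 - z ^ n = b * w" by blast
    have "1 - z ^ Suc n = (1 - z) + z * (1 - z ^ n)" by (simp add: algebra_simps)
    also have "\<dots> = b * (u + z * w)" unfolding w(2) by (simp add: z_def algebra_simps)
    finally show ?case using w u prime_int[OF z] by (intro exI[of _ "u + z * w"]) (auto intro: int_add int_mult)
  qed
  then obtain w where w: "algebraic_int w" "1 - z ^ n = b * w" by blast
  have "x = z ^ n * x + (1 - z ^ n) * x" by (simp add: algebra_simps)
  also have "\<dots> = z ^ n * x + \<pi> ^ n * (a * w)" unfolding w(2) using bx by (simp add: mult_ac)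
  also have "\<dots> \<in> prime_power n"
    by (intro prime_power_add prime_power_mult power_mem_prime_power z \<pi>(1) x int_mult ab w)
  finally show "x \<in> prime_power n" .
qed

text \<open>
  Suppose \<open>\<beta>\<^sup>2 / 2\<close> is a unit. Powers of a uniformizer \<open>\<pi>\<close> dividing \<open>\<beta>\<close> divide 2, so chains of
  divisors bound them, and \<open>\<beta> = \<pi> ^ k * w\<close> with \<open>w\<close> a unit. Then 2 is \<open>\<pi> ^ (2 * k)\<close> times a
  unit and has the even valuation \<open>2 * k\<close>; in particular the maximum in the definition of the
  valuation is attained.
\<close>

theorem two_not_unit_times_square:
  assumes odd_val: "odd (adic_valuation \<qq> 2)" and \<beta>: "\<beta>\<^sup>2 / 2 \<in> local_ring"
  shows "\<beta>\<^sup>2 / 2 \<in> maximal_ideal"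
proof (rule ccontr)
  assume not_max: "\<beta>\<^sup>2 / 2 \<notin> maximal_ideal"
  obtain \<pi> where \<pi>: "\<pi> \<in> \<qq>" "\<pi> \<noteq> 0" "\<And>y. y \<in> maximal_ideal \<Longrightarrow> y / \<pi> \<in> local_ring"
    using obtain_uniformizer by blast
  have \<pi>m: "\<pi> \<in> maximal_ideal" using \<pi>(1) int_mem_maximal_iff prime_int by blast
  have "2 * (\<beta>\<^sup>2 / 2) \<in> maximal_ideal" using two_mem_maximal \<beta> by (rule mult_mem_maximal)
  then have \<beta>V: "\<beta> \<in> local_ring" using square_mem maximal_ideal_subset by simp
  have \<beta>0: "\<beta> \<noteq> 0" using not_max zero_mem_maximal by auto
  have unit: "inverse (\<beta>\<^sup>2 / 2) \<in> local_ring" using not_max by (rule inverse_mem)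
  have "\<exists>k. \<beta> / \<pi> ^ k \<notin> local_ring"
  proof (rule ccontr)
    assume "\<not> ?thesis"
    then have all: "\<beta> / \<pi> ^ k \<in> local_ring" for k by blast
    have two_all: "2 / \<pi> ^ k \<in> maximal_ideal" for k
    proof -
      have "\<pi> * (\<beta> / \<pi> ^ Suc k * (\<beta> * inverse (\<beta>\<^sup>2 / 2))) \<in> maximal_ideal"
        using \<pi>m all \<beta>V unit by (intro mult_mem_maximal mult_mem)
      then show ?thesis using \<beta>0 \<pi>(2) by (simp add: power2_eq_square)
    qed
    obtain d where d: "\<And>r x. divisor_chain r x \<Longrightarrow> r \<le> d"
      using divisor_chain_bounded by blast
    have "\<pi> ^ (d - i) / \<pi> ^ (d - j) \<in> maximal_ideal" if "i < j" "j < Suc d" for i j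
    proof -
      from that have "d - i = (d - j) + Suc (j - i - 1)" by simp
      then have "\<pi> ^ (d - i) = \<pi> ^ (d - j) * (\<pi> * \<pi> ^ (j - i - 1))"
        by (simp only: power_add power_Suc)
      then show "\<pi> ^ (d - i) / \<pi> ^ (d - j) \<in> maximal_ideal"
        using \<pi>(2) \<pi>m maximal_ideal_subset by (simp add: mult_mem_maximal power_mem)
    qed
    then have "divisor_chain (Suc d) (\<lambda>i. \<pi> ^ (d - i))"
      using \<pi>m \<pi>(2) two_all maximal_ideal_subset unfolding divisor_chain_def
      by (auto intro: power_mem)
    then show False using d by fastforce
  qed
  then obtain k where k: "\<beta> / \<pi> ^ k \<in> local_ring" "\<beta> / \<pi> ^ Suc k \<notin> local_ring"
    using \<beta>V exists_least_lemma[of "\<lambda>k. \<beta> / \<pi> ^ k \<notin> local_ring"] by auto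
  define w where "w = \<beta> / \<pi> ^ k"
  have w: "w \<in> local_ring" "w \<notin> maximal_ideal"
    using k \<pi>(3)[of w] unfolding w_def by (auto simp: mult.commute)
  define unit2 where "unit2 = w\<^sup>2 * inverse (\<beta>\<^sup>2 / 2)"
  have two_eq: "2 = \<pi> ^ (2 * k) * unit2"
    using \<beta>0 \<pi>(2) unfolding unit2_def w_def by (simp add: power_mult field_simps power2_eq_square)
  have unit2: "unit2 \<in> local_ring" unfolding unit2_def by (intro mult_mem power_mem w(1) unit)
  have unit2_eq: "2 / \<pi> ^ (2 * k) = unit2"
  proof -
    have "\<pi> ^ (2 * k) * unit2 / \<pi> ^ (2 * k) = unit2" using \<pi>(2) by simp
    then show ?thesis unfolding two_eq[symmetric] .
  qed
  have "adic_valuation \<qq> 2 = 2 * k"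
    unfolding adic_valuation_def
  proof (rule Greatest_equality)
    show "2 \<in> prime_power (2 * k)"
      using unit2 unit2_eq mem_prime_power_iff[OF \<pi> prime_int[OF two_mem]] by metis
  next
    fix j assume "2 \<in> prime_power j"
    then have j: "2 / \<pi> ^ j \<in> local_ring"
      using mem_prime_power_iff[OF \<pi> prime_int[OF two_mem]] by metis
    show "j \<le> 2 * k"
    proof (rule ccontr)
      assume "\<not> j \<le> 2 * k"
      then have "j = 2 * k + Suc (j - 2 * k - 1)" by simp
      then have split: "\<pi> ^ j = \<pi> ^ (2 * k) * (\<pi> * \<pi> ^ (j - 2 * k - 1))"
        by (metis power_Suc power_add)
      have cancel: "2 / e = p * (t * (2 / (e * (p * t))))" if "e \<noteq> 0" "p \<noteq> 0" "t \<noteq> 0" for e p t :: 'a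
        using that by simp
      have "unit2 = \<pi> * (\<pi> ^ (j - 2 * k - 1) * (2 / \<pi> ^ j))"
        unfolding unit2_eq[symmetric] split by (rule cancel) (use \<pi>(2) in simp_all)
      also have "\<dots> \<in> maximal_ideal"
        using j \<pi>m maximal_ideal_subset by (intro mult_mem_maximal mult_mem power_mem) auto
      finally have "w * w * inverse (\<beta>\<^sup>2 / 2) * (\<beta>\<^sup>2 / 2) \<in> maximal_ideal"
        using \<beta> unfolding unit2_def power2_eq_square by (rule mult_mem_maximal)
      then have "w * w \<in> maximal_ideal" using \<beta>0 by (simp add: mult.assoc)
      then show False using maximal_prime w(2) by blast
    qed
  qed
  then show False using odd_val by simp
qed

end

section \<open>Iterates of a quadratic polynomial\<close>

lemma poly_iterate_0: "poly_iterate f 0 = [:0, 1:]"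
  by (simp add: poly_iterate_def)

lemma poly_iterate_Suc: "poly_iterate f (Suc n) = pcompose f (poly_iterate f n)"
  by (simp add: poly_iterate_def)

lemma poly_iterate_Suc': "poly_iterate f (Suc n) = pcompose (poly_iterate f n) f"
  for f :: "'a::comm_ring_1 poly"
  by (induction n) (simp_all add: poly_iterate_0 poly_iterate_Suc pcompose_pCons pcompose_assoc)

text \<open>
  Translating the critical point \<open>\<gamma>\<close> to the origin conjugates \<open>f\<close> to \<open>y\<^sup>2 + m\<close>.
\<close>

lemma poly_iterate_conjugate:
  fixes \<gamma> m :: "'a::comm_ring_1"
  defines "f \<equiv> [:-\<gamma>, 1:]\<^sup>2 + [:\<gamma> + m:]"
  shows "pcompose (poly_iterate f n) [:\<gamma>, 1:] = poly_iterate [:m, 0, 1:] n + [:\<gamma>:]"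
proof (induction n)
  case 0
  then show ?case by (simp add: poly_iterate_0 pcompose_pCons)
next
  case (Suc n)
  have "pcompose (poly_iterate f (Suc n)) [:\<gamma>, 1:] =
        pcompose f (poly_iterate [:m, 0, 1:] n + [:\<gamma>:])"
    by (simp add: poly_iterate_Suc Suc flip: pcompose_assoc)
  also have "\<dots> = (poly_iterate [:m, 0, 1:] n)\<^sup>2 + [:\<gamma> + m:]"
    unfolding f_def pcompose_add power2_eq_square pcompose_mult
    by (simp only: pcompose_pCons pcompose_const) (simp add: algebra_simps)
  also have "\<dots> = poly_iterate [:m, 0, 1:] (Suc n) + [:\<gamma>:]"
    by (simp add: poly_iterate_Suc pcompose_pCons power2_eq_square)
  finally show ?case .
qed

lemma poly_iterate_quadratic:
  fixes m :: "'a::idom"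
  shows "degree (poly_iterate [:m, 0, 1:] n) = 2 ^ n" "lead_coeff (poly_iterate [:m, 0, 1:] n) = 1"
proof (induction n)
  case (Suc n)
  { case 1 show ?case unfolding poly_iterate_Suc degree_pcompose Suc(1) by simp }
  { case 2
    have "lead_coeff (poly_iterate [:m, 0, 1:] (Suc n)) =
          lead_coeff [:m, 0, 1:] * lead_coeff (poly_iterate [:m, 0, 1:] n) ^ degree [:m, 0, 1:]"
      unfolding poly_iterate_Suc by (rule lead_coeff_comp) (simp add: Suc(1))
    then show ?case unfolding Suc(2) by simp }
qed (simp_all add: poly_iterate_0)

theorem theorem1p3:
  fixes \<qq> :: "'a::field_char_0 set" and \<gamma> m :: 'a and f :: "'a poly"
  assumes "number_field TYPE('a)"
    and "primeideal \<qq> ring_of_integers" and "\<qq> \<noteq> {0}"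
    and "odd (adic_valuation \<qq> 2)"
    and "\<gamma> \<in> carrier ring_of_integers" and "m \<in> carrier ring_of_integers"
    and "f = [:-\<gamma>, 1:]^2 + [:\<gamma> + m:]"
    and "\<gamma> - m \<notin> \<qq>"
    and "\<not> (\<exists>s. s^2 = -(\<gamma> + m))"
  shows "\<forall>n\<ge>1. Factorial_Ring.irreducible (poly_iterate f n)"
proof -
  interpret integer_prime \<qq> by (rule integer_prime.intro) (rule assms(2))
  interpret prime_above_two \<qq>
    by unfold_locales (rule assms(1), rule two_mem_if_odd_valuation, rule assms(4))
  have int: "algebraic_int \<gamma>" "algebraic_int m" using assms(5,6) by (simp_all add: ring_of_integers_def)
  define g where "g = [:m, 0, 1:]"
  define G where "G = (\<lambda>n. poly_iterate g n + [:\<gamma>:])"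
  note g_iterate = poly_iterate_quadratic[of m, folded g_def]
  have unit: "\<gamma> + m \<notin> maximal_ideal"
  proof
    assume "\<gamma> + m \<in> maximal_ideal"
    then have "\<gamma> + m \<in> \<qq>" using int_mem_maximal_iff int int_add by blast
    \<comment> \<open>The sum and the difference of \<open>\<gamma>\<close> and \<open>m\<close> agree modulo \<open>\<qq>\<close>, which contains 2.\<close>
    then have "\<gamma> + m - 2 * m \<in> \<qq>" by (rule prime_diff) (rule prime_mult'[OF two_mem int(2)])
    then show False using assms(8) by simp
  qed
  have m_coeffs: "coeff [:m, 0, 1:] i \<in> local_ring" "coeff [:m, 1:] i \<in> local_ring" for i
    using int_local[OF int(2)] zero_mem one_mem by (auto simp: coeff_pCons split: nat.split)
  have iterate_coeffs: "coeff (poly_iterate g k) i \<in> local_ring" for k i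
  proof (induction k arbitrary: i)
    case 0
    show ?case using zero_mem one_mem by (auto simp: poly_iterate_0 coeff_pCons split: nat.split)
  next
    case (Suc k)
    then show ?case
      unfolding poly_iterate_Suc using m_coeffs unfolding g_def by (intro coeff_pcompose_mem)
  qed
  have G_Suc: "G (Suc k) = (poly_iterate g k)\<^sup>2 + [:\<gamma> + m:]" for k
    by (simp add: G_def g_def poly_iterate_Suc pcompose_pCons power2_eq_square)
  have "Factorial_Ring.irreducible (G n)" if "n \<ge> 1" for n
    using that
  proof (induction n rule: dec_induct)
    case base
    have "G 1 = [:\<gamma> + m, 0, 1:]"
      using G_Suc[of 0] by (simp add: poly_iterate_0 power2_eq_square)
    then show ?case using irreducible_quadratic[OF assms(9)] by simp
  next
    case (step n)
    then obtain k where n: "n = Suc k" by (cases n) auto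
    \<comment> \<open>Here \<open>G (n + 1) = P(y\<^sup>2)\<close>, and \<open>P\<close> is a translate of \<open>G n\<close>.\<close>
    define P where "P = pcompose (G n) [:m, 1:]"
    define Q where "Q = pcompose (poly_iterate g k) [:m, 1:]"
    have P_eq: "P = Q\<^sup>2 + [:\<gamma> + m:]"
      unfolding P_def Q_def n G_Suc by (simp add: pcompose_add power2_eq_square pcompose_mult)
    have Q: "lead_coeff Q = 1" "degree Q = 2 ^ k"
      unfolding Q_def degree_pcompose using lead_coeff_comp[of "[:m, 1:]" "poly_iterate g k"]
      by (simp_all add: g_iterate(1)) (use g_iterate in simp)
    have dG: "degree (G n) = 2 ^ n"
      unfolding G_def by (subst degree_add_eq_left) (simp_all add: g_iterate)
    have lG: "lead_coeff (G n) = 1"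
      using lead_coeff_add_le[of "[:\<gamma>:]" "poly_iterate g n"] g_iterate[of n]
      unfolding G_def by (simp add: add.commute)
    have "Factorial_Ring.irreducible (pcompose P [:0, 0, 1:])"
    proof (rule irreducible_pcompose_square)
      show "Factorial_Ring.irreducible P"
        unfolding P_def by (rule irreducible_pcompose_translate) (rule step.IH)
      show "lead_coeff P = 1" unfolding P_def by (subst lead_coeff_comp) (simp_all only: lG, simp_all)
      show "even (degree P)" unfolding P_def by (simp add: degree_pcompose dG) (simp add: n)
      show "P \<noteq> A\<^sup>2 - [:0, 1:] * B\<^sup>2" for A B
        unfolding P_eq
      proof (rule square_plus_unit_not_norm_form[OF two_mem_maximal])
        show "coeff Q i \<in> local_ring" for i
          unfolding Q_def by (rule coeff_pcompose_mem[OF iterate_coeffs m_coeffs(2)])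
        show "\<gamma> + m \<in> local_ring" using int_local int int_add by blast
        show "\<beta>\<^sup>2 / 2 \<in> maximal_ideal" if "\<beta>\<^sup>2 / 2 \<in> local_ring" for \<beta>
          using two_not_unit_times_square[OF assms(4) that] .
      qed (use Q unit in auto)
    qed
    also have "pcompose P [:0, 0, 1:] = G (Suc n)"
      unfolding P_def G_def poly_iterate_Suc' pcompose_add
      by (simp add: pcompose_pCons g_def flip: pcompose_assoc)
    finally show ?case .
  qed
  moreover have "poly_iterate f n = pcompose (G n) [:-\<gamma>, 1:]" for n
    unfolding G_def g_def assms(7) poly_iterate_conjugate[symmetric]
    by (simp add: pcompose_pCons flip: pcompose_assoc)
  ultimately show ?thesis using irreducible_pcompose_translate by metis
qed

end
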